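(* Let $d=1$ and $\alpha\in(1/3,1)$, and let $(W_n)_{n\ge 0}$ be the embedded process of the orthogonal continuous-time conservative walk (Model A) on $\mathbb{R}$ generated by the rate function $\lambda(t)=t^{-\alpha}$, $t>0$. Then $W_n$ is transient almost surely.
   Context: Model A (orthogonal conservative walk) on $\mathbb{R}^d$, $d\ge 1$: Let $\lambda\ge 0$ be a rate function with $\Lambda(T)=\int_0^T\lambda(t)\,dt<\infty$ for all $T\ge 0$ and $\Lambda(T)\to\infty$ as $T\to\infty$. Let $\tau_0=0$ and let $\tau_1<\tau_2<\dots$ be the consecutive points of a non-homogeneous Poisson point process on $[0,\infty)$ with rate $\lambda(t)$. Let $\mathbf f_0,\mathbf f_1,\mathbf f_2,\dots$ be i.i.d. random vectors, independent of $(\tau_k)_{k\ge1}$, each uniformly distributed on the set of $2d$ unit vectors $\{\pm \mathbf e_1,\dots,\pm\mathbf e_d\}$ of $\mathbb{R}^d$ (so for $d=1$, $\mathbf f_k$ is uniform on $\{-1,+1\}$). The embedded process is $W_0=0$ and $$W_n=\sum_{k=0}^{n-1}(\tau_{k+1}-\tau_k)\mathbf f_k,\qquad n\ge 1.$$ Transience: for $\rho\ge 0$, $W_n$ is $\rho$-recurrent if there is a strictly increasing infinite sequence of positive integers $n_1<n_2<\dots$ with $W_{n_i}\in[-\rho,\rho]^d$ for all $i$. $W_n$ is transient if it is not $\rho$-recurrent for any $\rho>0$, equivalently $\lim_{n\to\infty}\|W_n\|=\infty$. *)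

theory Defs
  imports "HOL-Probability.Probability"
begin

definition rate_function :: "(real \<Rightarrow> real) \<Rightarrow> bool" where
  "rate_function lam \<longleftrightarrow>
     (\<forall>t\<ge>0. lam t \<ge> 0) \<and>
     (\<forall>T\<ge>0. set_integrable lborel {0..T} lam) \<and>
     filterlim (\<lambda>T. LINT t:{0..T}|lborel. lam t) at_top at_top"

(* Stated through point probabilities rather than poisson_pmf, which requires a
   strictly positive rate; for r = 0 this is the point mass at 0. *)
definition (in prob_space) poisson_variable :: "real \<Rightarrow> ('a \<Rightarrow> nat) \<Rightarrow> bool" where
  "poisson_variable r N \<longleftrightarrow>
     random_variable (count_space UNIV) N \<and>
     (\<forall>k. prob {w \<in> space M. N w = k} = r ^ k / fact k * exp (- r))"

(* A (simple) point process is a random set pts w of points. Almost sure local finiteness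
   is required explicitly because card of an infinite set is 0. *)
definition (in prob_space) poisson_point_process ::
    "(real \<Rightarrow> real) \<Rightarrow> ('a \<Rightarrow> real set) \<Rightarrow> bool" where
  "poisson_point_process lam pts \<longleftrightarrow>
     (AE w in M. pts w \<subseteq> {0..} \<and> (\<forall>T. finite (pts w \<inter> {0..T}))) \<and>
     (\<forall>A. A \<in> sets borel \<and> bounded A \<and> A \<subseteq> {0..} \<longrightarrow>
        poisson_variable (LINT t:A|lborel. lam t) (\<lambda>w. card (pts w \<inter> A))) \<and>
     (\<forall>(n::nat) A.
        (\<forall>i<n. A i \<in> sets borel \<and> bounded (A i) \<and> A i \<subseteq> {0..}) \<and>
        disjoint_family_on A {..<n} \<longrightarrow>
        indep_vars (\<lambda>_. count_space UNIV) (\<lambda>i w. card (pts w \<inter> A i)) {..<n})"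

(* The set of the 2d vectors +e_i, -e_i; for 'v = real it is {1, -1}. *)
definition signed_unit_vectors :: "'v::euclidean_space set" where
  "signed_unit_vectors = Basis \<union> uminus ` Basis"

(* R^d is the type 'v, with d = DIM('v). Clause tau_increasing together with tau_poisson
   says that tau 1 < tau 2 < ... enumerates the points of the process. Independence of the two sequences is stated through
   the sigma-algebras they generate, because indep_var forces equal value types. *)
locale orthogonal_conservative_walk = prob_space M for M :: "'a measure" +
  fixes lam :: "real \<Rightarrow> real"
    and tau :: "nat \<Rightarrow> 'a \<Rightarrow> real"
    and f :: "nat \<Rightarrow> 'a \<Rightarrow> 'v::euclidean_space"
  assumes rate: "rate_function lam"
    and tau_measurable: "\<And>k. random_variable borel (tau k)"
    and tau_0: "\<And>w. w \<in> space M \<Longrightarrow> tau 0 w = 0"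
    and tau_increasing: "AE w in M. strict_mono_on {1..} (\<lambda>k. tau k w)"
    and tau_poisson: "poisson_point_process lam (\<lambda>w. (\<lambda>k. tau k w) ` {1..})"
    and f_measurable: "\<And>k. random_variable borel (f k)"
    and f_uniform:
      "\<And>k. distr M borel (f k) =
           distr (measure_pmf (pmf_of_set signed_unit_vectors)) borel (\<lambda>v. v)"
    and f_indep: "indep_vars (\<lambda>_. borel) f UNIV"
    and f_tau_indep:
      "indep_set
         (sets (vimage_algebra (space M) (\<lambda>w. \<lambda>k\<in>UNIV. f k w) (PiM UNIV (\<lambda>_. borel))))
         (sets (vimage_algebra (space M) (\<lambda>w. \<lambda>k\<in>{1..}. tau k w) (PiM {1..} (\<lambda>_. borel))))"

definition embedded_process ::
    "(nat \<Rightarrow> 'a \<Rightarrow> real) \<Rightarrow> (nat \<Rightarrow> 'a \<Rightarrow> 'v::euclidean_space) \<Rightarrow> nat \<Rightarrow> 'a \<Rightarrow> 'v" where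
  "embedded_process tau f n w = (\<Sum>k<n. (tau (Suc k) w - tau k w) *\<^sub>R f k w)"

(* cbox (- (rho *R One)) (rho *R One) is the cube [-rho, rho]^d. *)
definition recurrent_radius :: "real \<Rightarrow> (nat \<Rightarrow> 'v::euclidean_space) \<Rightarrow> bool" where
  "recurrent_radius rho x \<longleftrightarrow>
     (\<exists>n::nat \<Rightarrow> nat. strict_mono n \<and> (\<forall>i. n i \<ge> 1 \<and> x (n i) \<in> cbox (- (rho *\<^sub>R One)) (rho *\<^sub>R One)))"

definition transient :: "(nat \<Rightarrow> 'v::euclidean_space) \<Rightarrow> bool" where
  "transient x \<longleftrightarrow> (\<forall>rho>0. \<not> recurrent_radius rho x)"

end

theory Submission
  imports Defs "HOL-Real_Asymp.Real_Asymp"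
begin

text \<open>
  Let \<open>X(T)\<close> be the position at time \<open>T\<close> of the path that moves with unit speed and takes a fresh random
  direction at every turning time; at the \<open>n\<close>-th turning time its value is \<open>W\<^sub>n\<close>. If the embedded process
  returns to \<open>[-\<rho>, \<rho>]\<close> at a turning time in \<open>(j, j + 1]\<close>, then this interval contains a turning time and
  \<open>\<bar>X(j)\<bar> \<le> \<rho> + 1\<close>. These two events are independent. The first one has probability at most \<open>j powr (- alpha)\<close>.
  By time \<open>j\<close> there are about \<open>j powr (1 - alpha)\<close> gaps, of typical length \<open>j powr alpha\<close>, so that
  \<open>X(j)\<close> has standard deviation of order \<open>j powr ((1 + alpha) / 2)\<close>, and a local limit heuristic suggests
  that the second event has probability of the order of the inverse. The sum over \<open>j\<close> of
  \<open>j powr (- alpha - (1 + alpha) / 2)\<close> converges exactly when \<open>alpha > 1 / 3\<close>, and the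
  Borel--Cantelli lemma gives transience.

  The local bound must hold at the fixed scale \<open>\<rho> + 1\<close>, far below the length of a single gap.
  The signs alone cannot give it; the continuous distribution of the turning times has to be used.
  It is obtained on the Fourier side. A Fejer kernel bounds \<open>P(\<bar>X\<bar> \<le> R)\<close> by the integral of
  \<open>E cos (v X)\<close> over \<open>0 \<le> v \<le> 1 / R\<close>
  (\<open>cos_triangle_integral_ge\<close>, \<open>prob_near_origin_le_integral\<close>). Given the turning times, the signs
  average to a product of \<open>cos (v \<xi>)\<close> over the gaps \<open>\<xi>\<close> (\<open>expectation_cos_given_times\<close>).

  To average this product over the times, \<open>[j / 2, j]\<close> is cut into cells of length \<open>2 s\<close> with
  \<open>s = j powr alpha\<close>. For each frequency \<open>v\<close>, every cell contains two subsets \<open>A\<close> and \<open>B\<close>, each of length at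
  least \<open>s / 4\<close>, such that \<open>1 - \<bar>cos (v (y - x))\<bar>\<close> is at least a constant times \<open>min 1 ((v s)\<^sup>2)\<close> for all
  \<open>x\<close> in \<open>A\<close> and \<open>y\<close> in \<open>B\<close> (\<open>comb_separation\<close>). If the cell contains exactly two
  points, one in \<open>A\<close> and one in \<open>B\<close>, these are consecutive turning times and their gap contributes a factor
  smaller than \<open>1\<close> (\<open>prod_cos_gaps_le\<close>). This pattern is described by counts in three disjoint sets, hence it
  occurs independently in the cells and independently of the points in \<open>(j, j + 1]\<close>, with a probability bounded
  below (\<open>expectation_poisson_cells\<close>). Since \<open>A\<close> and \<open>B\<close> may be arbitrary Borel sets, the argument works directly with the
  independence of counts that defines the Poisson process, instead of the joint law of the gaps.
  The result is a bound \<open>exp (- \<kappa> j powr (1 - alpha) min 1 ((v s)\<^sup>2))\<close>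
  (\<open>expectation_cos_stopped_powr_le\<close>), whose integral over \<open>v\<close> has the order predicted above
  (\<open>prob_near_origin_le\<close>).
\<close>

section \<open>A Fejer majorant of an interval\<close>

text \<open>
  The triangle \<open>1 - u\<close> on \<open>[0, 1]\<close> is, after even reflection, the Fourier transform of a nonnegative
  function, the Fejer kernel. Hence four times the integral majorizes the indicator of
  \<open>\<bar>y\<bar> \<le> 1\<close>, while only frequencies \<open>u\<close> in \<open>[0, 1]\<close> occur in it. This turns a bound on
  \<open>E cos (u X / R)\<close> for those \<open>u\<close> into a bound on \<open>P(\<bar>X\<bar> \<le> R)\<close>.
\<close>

lemma cos_triangle_integral:
  fixes y :: real
  assumes "y \<noteq> 0"
  shows "(LBINT u:{0..1}. (1 - u) * cos (u * y)) = (1 - cos y) / y\<^sup>2"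
proof -
  have "(LBINT u. indicator {0..1} u *\<^sub>R ((1 - u) * cos (u * y)))
      = ((1 - 1) * sin (1 * y) / y - cos (1 * y) / y\<^sup>2) - ((1 - 0) * sin (0 * y) / y - cos (0 * y) / y\<^sup>2)"
  proof (rule integral_FTC_Icc[where F = "\<lambda>u. (1 - u) * sin (u * y) / y - cos (u * y) / y\<^sup>2"])
    show "((\<lambda>u. (1 - u) * sin (u * y) / y - cos (u * y) / y\<^sup>2) has_vector_derivative (1 - x) * cos (x * y))
           (at x within {0..1})" for x
      unfolding has_real_derivative_iff_has_vector_derivative[symmetric]
      by (rule derivative_eq_intros refl | use assms in \<open>force simp: field_simps power2_eq_square\<close>)+
  qed (auto intro!: continuous_intros)
  then show ?thesis
    by (simp add: set_lebesgue_integral_def diff_divide_distrib)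
qed

lemma cos_triangle_integral_nonneg:
  "0 \<le> (LBINT u:{0..1::real}. (1 - u) * cos (u * y))"
proof (cases "y = 0")
  case False
  then show ?thesis by (simp add: cos_triangle_integral)
next
  case True
  show ?thesis unfolding True set_lebesgue_integral_def
    by (rule integral_nonneg_AE) (auto simp: indicator_def)
qed

text \<open>
  For \<open>\<bar>y\<bar> \<le> 1\<close> all the arguments of the cosine are at most \<open>1 < \<pi> / 3\<close>, so the cosine is at least
  \<open>1 / 2\<close>, and the triangle has area \<open>1 / 2\<close>.
\<close>

lemma cos_triangle_integral_ge:
  fixes y :: real
  assumes "\<bar>y\<bar> \<le> 1"
  shows "1 / 4 \<le> (LBINT u:{0..1}. (1 - u) * cos (u * y))"
proof -
  have "(LBINT u. indicator {0..1} u *\<^sub>R ((1 - u) / 2))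
      = (1 / 2 - 1\<^sup>2 / 4) - (0 / 2 - 0\<^sup>2 / 4 :: real)"
  proof (rule integral_FTC_Icc[where F = "\<lambda>u. u / 2 - u\<^sup>2 / 4"])
    show "((\<lambda>u. u / 2 - u\<^sup>2 / 4) has_vector_derivative (1 - x) / 2) (at x within {0..1})" for x :: real
      unfolding has_real_derivative_iff_has_vector_derivative[symmetric]
      by (rule derivative_eq_intros refl | force simp: field_simps)+
  qed (auto intro!: continuous_intros)
  then have "1 / 4 = (LBINT u:{0..1::real}. (1 - u) / 2)"
    by (simp add: set_lebesgue_integral_def)
  also have "\<dots> \<le> (LBINT u:{0..1}. (1 - u) * cos (u * y))"
  proof (rule set_integral_mono)
    fix u :: real assume u: "u \<in> {0..1}"
    have "\<bar>u * y\<bar> \<le> 1" using u assms by (simp add: abs_mult mult_le_one)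
    moreover have "1 < pi / 3" using pi_gt3 by simp
    ultimately have "cos (pi / 3) \<le> cos \<bar>u * y\<bar>" by (intro cos_monotone_0_pi_le) auto
    then have "1 / 2 \<le> cos (u * y)" by (simp add: cos_60)
    then show "(1 - u) / 2 \<le> (1 - u) * cos (u * y)"
      using u mult_left_mono[of "1/2" "cos (u * y)" "1 - u"] by simp
  qed (auto intro!: borel_integrable_atLeastAtMost' continuous_intros)
  finally show ?thesis .
qed

section \<open>Sets whose gaps avoid the resonances of a frequency\<close>

lemma sin_ge_half: "x / 2 \<le> sin x" if "0 \<le> x" "x \<le> 1" for x :: real
proof -
  have c: "1/2 \<le> cos t" if "0 \<le> t" "t \<le> 1" for t :: real
  proof -
    have "cos (pi/3) \<le> cos t" using that pi_gt3 by (intro cos_monotone_0_pi_le) auto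
    then show ?thesis by (simp add: cos_60)
  qed
  have "(\<lambda>t. sin t - t/2) 0 \<le> (\<lambda>t. sin t - t/2) x"
  proof (rule DERIV_nonneg_imp_nondecreasing[OF that(1)])
    fix t assume "0 \<le> t" "t \<le> x"
    then show "\<exists>z. ((\<lambda>t. sin t - t/2) has_real_derivative z) (at t) \<and> 0 \<le> z"
      using c[of t] that by (intro exI[of _ "cos t - 1/2"] conjI) (auto intro!: derivative_eq_intros)
  qed
  then show ?thesis by simp
qed

lemma cos_le_quadratic: "cos x \<le> 1 - x\<^sup>2 / 8" if "0 \<le> x" "x \<le> 2" for x :: real
proof -
  have "cos x = 1 - 2 * (sin (x/2))\<^sup>2" using cos_double_sin[of "x/2"] by simp
  moreover have "(x/4)\<^sup>2 \<le> (sin (x/2))\<^sup>2" using sin_ge_half[of "x/2"] that by (intro power_mono) auto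
  ultimately show ?thesis by (simp add: power2_eq_square field_simps)
qed

text \<open>
  The first quarters of \<open>n\<close> successive periods of length \<open>P\<close>, starting from \<open>a\<close>. The combs with
  offsets \<open>a\<close> and \<open>a + P / 2\<close> face each other at distances that avoid a neighbourhood of the
  multiples of \<open>P\<close>.
\<close>

definition comb :: "real \<Rightarrow> real \<Rightarrow> nat \<Rightarrow> real set" where
  "comb a P n = (\<Union>i<n. {a + real i * P ..< a + real i * P + P / 4})"

lemma comb_borel [measurable]: "comb a P n \<in> sets borel"
  unfolding comb_def by auto

lemma comb_subset:
  assumes "P > 0"
  shows "comb a P n \<subseteq> {a..<a + real n * P}" "comb (a + P / 2) P n \<subseteq> {a..<a + real n * P}"
proof -
  have *: "real i * P + P \<le> real n * P" "0 \<le> real i * P" if "i < n" for i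
    using mult_right_mono[of "real i + 1" "real n" P] that assms by (auto simp: algebra_simps)
  show "comb a P n \<subseteq> {a..<a + real n * P}"
  proof
    fix x assume "x \<in> comb a P n"
    then obtain i where i: "i < n" "a + real i * P \<le> x" "x < a + real i * P + P / 4" by (auto simp: comb_def)
    then show "x \<in> {a..<a + real n * P}" using *[OF i(1)] i(2,3) assms unfolding atLeastLessThan_iff by linarith
  qed
  show "comb (a + P / 2) P n \<subseteq> {a..<a + real n * P}"
  proof
    fix x assume "x \<in> comb (a + P / 2) P n"
    then obtain i where i: "i < n" "a + P / 2 + real i * P \<le> x" "x < a + P / 2 + real i * P + P / 4"
      by (auto simp: comb_def)
    then show "x \<in> {a..<a + real n * P}" using *[OF i(1)] i(2,3) assms unfolding atLeastLessThan_iff by linarith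
  qed
qed

lemma comb_difference:
  assumes "P > 0" "x \<in> comb a P n" "y \<in> comb (a + P / 2) P n"
  shows "\<exists>(k::int) d. y - x = of_int k * P + d \<and> P / 4 < d \<and> d < 3 * P / 4 \<and> (n = 1 \<longrightarrow> k = 0)"
proof -
  obtain i i' where i: "i < n" "x \<in> {a + real i * P ..< a + real i * P + P / 4}"
    and i': "i' < n" "y \<in> {a + P / 2 + real i' * P ..< a + P / 2 + real i' * P + P / 4}"
    using assms by (auto simp: comb_def)
  show ?thesis
  proof (rule exI[of _ "int i' - int i"], rule exI[of _ "y - x - of_int (int i' - int i) * P"], intro conjI)
    show "P / 4 < y - x - of_int (int i' - int i) * P" "y - x - of_int (int i' - int i) * P < 3 * P / 4"
      using i i' assms by (auto simp: algebra_simps)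
  qed (use i i' in auto)
qed

lemma comb_disjoint:
  assumes "P > 0"
  shows "comb a P n \<inter> comb (a + P / 2) P n = {}"
proof (rule ccontr)
  assume "\<not> ?thesis"
  then obtain x where "x \<in> comb a P n" "x \<in> comb (a + P / 2) P n" by auto
  from comb_difference[OF assms this] obtain k :: int and d
    where "x - x = of_int k * P + d" and d: "P / 4 < d" "d < 3 * P / 4" by blast
  then have *: "0 = of_int k * P + d" by simp
  have "k < 0 \<or> k \<ge> 0" by auto
  then show False
  proof
    assume "k < 0"
    then have "of_int k * P \<le> (-1) * P" using assms by (intro mult_right_mono) auto
    with * d assms show False by simp
  next
    assume "k \<ge> 0"
    then have "of_int k * P \<ge> 0" using assms by simp
    with * d assms show False by simp
  qed
qed

lemma measure_comb:
  assumes "P > 0"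
  shows "measure lborel (comb a P n) = real n * P / 4"
proof -
  have "disjoint_family_on (\<lambda>i. {a + real i * P ..< a + real i * P + P / 4}) {..<n}"
  proof (unfold disjoint_family_on_def, intro ballI impI)
    fix i i' :: nat assume "i \<noteq> i'"
    then have "real i * P + P \<le> real i' * P \<or> real i' * P + P \<le> real i * P"
      using mult_right_mono[of "real i + 1" "real i'" P] mult_right_mono[of "real i' + 1" "real i" P] assms
      by (auto simp: algebra_simps neq_iff)
    then show "{a + real i * P ..< a + real i * P + P / 4} \<inter> {a + real i' * P ..< a + real i' * P + P / 4} = {}"
      using assms by auto
  qed
  then show ?thesis unfolding comb_def
    by (subst measure_finite_Union) (use assms in auto)
qed

lemma abs_cos_shift_le:
  fixes k :: int and t :: real
  assumes "pi / 4 \<le> t" "t \<le> 3 * pi / 4"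
  shows "\<bar>cos (of_int k * pi + t)\<bar> \<le> 3 / 4"
proof -
  have "0 \<le> cos (pi - 2 * t) "
    using assms by (intro cos_ge_zero) auto
  then have "cos (2 * t) \<le> 0" by (simp add: cos_diff)
  moreover have "cos (2 * (of_int k * pi + t)) = cos (2 * t)"
    using cos_add[of "of_int k * (2 * pi)" "2 * t"] sin_int_2pin[of k] cos_int_2pin[of k]
    by (simp add: algebra_simps)
  ultimately have "(cos (of_int k * pi + t))\<^sup>2 \<le> 1 / 2"
    using cos_double_cos[of "of_int k * pi + t"] by simp
  also have "\<dots> \<le> (3 / 4)\<^sup>2" by (simp add: power2_eq_square)
  finally show ?thesis by (subst (asm) abs_le_square_iff[symmetric]) simp
qed

text \<open>
  In a cell of length \<open>2 s\<close> one finds two sets, each filling a fixed proportion of the cell, such that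
  any gap \<open>d\<close> from one to the other keeps \<open>\<bar>cos (v d)\<bar>\<close> away from \<open>1\<close>. At a low frequency
  \<open>v \<le> \<pi> / (2 s)\<close>, gaps between \<open>s / 4\<close> and \<open>3 s / 4\<close> keep \<open>v d\<close> below \<open>\<pi> / 2\<close>, so that the lower bound
  on \<open>d\<close> gives a gain quadratic in \<open>v s\<close>; one period of length \<open>s\<close> produces such gaps. At a higher frequency the period is \<open>\<pi> / v\<close>, that of \<open>\<bar>cos (v d)\<bar>\<close>, and the gain is a constant. One period
  of length \<open>\<pi> / v\<close> fits because the cell has length \<open>2 s\<close>.
\<close>

lemma comb_separation:
  fixes s v :: real
  assumes "s > 0" "v \<ge> 0"
  obtains P n where "P > 0" "s \<le> real n * P" "real n * P \<le> 2 * s"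
    "\<And>a x y. x \<in> comb a P n \<Longrightarrow> y \<in> comb (a + P / 2) P n \<Longrightarrow>
        \<bar>cos (v * (y - x))\<bar> \<le> 1 - min 1 ((v * s)\<^sup>2) / 128"
proof (cases "v * s \<le> pi / 2")
  case True
  show ?thesis
  proof (rule that[of s 1])
    fix a x y assume xy: "x \<in> comb a s 1" "y \<in> comb (a + s / 2) s 1"
    have d: "s / 4 < y - x" "y - x < 3 * s / 4"
      using xy by (auto simp: comb_def split: if_splits)
    define d where "d = y - x"
    note d = d[folded d_def]
    have "v * d \<le> v * (3 * s / 4)" using d assms by (intro mult_left_mono) auto
    then have le: "v * d \<le> 3 * pi / 8" using True by simp
    have ge: "v * s / 4 \<le> v * d" using d assms mult_left_mono[of "s / 4" d v] by simp
    have nn: "0 \<le> v * s" using assms by simp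
    have "0 \<le> cos (v * d)" using le ge nn pi_gt_zero by (intro cos_ge_zero) auto
    then have "\<bar>cos (v * d)\<bar> = cos (v * d)" by simp
    also have "\<dots> \<le> 1 - (v * d)\<^sup>2 / 8" using le ge nn pi_less_4 by (intro cos_le_quadratic) auto
    also have "\<dots> \<le> 1 - (v * s / 4)\<^sup>2 / 8" using power_mono[OF ge, of 2] nn by simp
    also have "\<dots> \<le> 1 - min 1 ((v * s)\<^sup>2) / 128" by (simp add: power_divide)
    finally show "\<bar>cos (v * (y - x))\<bar> \<le> 1 - min 1 ((v * s)\<^sup>2) / 128" by (simp add: d_def)
  qed (use assms in auto)
next
  case False
  then have v: "v > 0" using assms pi_gt_zero by (cases "v = 0") auto
  define P where "P = pi / v"
  have P: "P > 0" "P \<le> 2 * s" "v * P = pi" using False v by (auto simp: P_def field_simps)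
  define n where "n = nat \<lfloor>2 * s / P\<rfloor>"
  have r: "2 * s / P \<ge> 1" using P by simp
  have n: "real n = of_int \<lfloor>2 * s / P\<rfloor>" using r by (simp add: n_def)
  have n1: "real n \<le> 2 * s / P" "2 * s / P < real n + 1" unfolding n by linarith+
  have "1 \<le> n" using r unfolding n_def by linarith
  then have n2: "s / P \<le> real n" using n1(2) by simp
  show ?thesis
  proof (rule that[OF P(1), of n])
    show "s \<le> real n * P" "real n * P \<le> 2 * s"
      using n1 n2 P by (simp_all add: field_simps)
    fix a x y assume xy: "x \<in> comb a P n" "y \<in> comb (a + P / 2) P n"
    from comb_difference[OF P(1) xy] obtain k :: int and d
      where d: "y - x = of_int k * P + d" "P / 4 < d" "d < 3 * P / 4" by blast
    have vd: "v * (y - x) = of_int k * pi + v * d"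
      unfolding d(1) P(3)[symmetric] by (simp add: algebra_simps)
    have "v * (P / 4) \<le> v * d" "v * d \<le> v * (3 * P / 4)"
      using d v by (intro mult_left_mono; simp)+
    then have "pi / 4 \<le> v * d" "v * d \<le> 3 * pi / 4" using P(3) by auto
    from abs_cos_shift_le[OF this, of k] have "\<bar>cos (v * (y - x))\<bar> \<le> 3 / 4" unfolding vd .
    also have "\<dots> \<le> 1 - min 1 ((v * s)\<^sup>2) / 128" by (auto simp: min_def)
    finally show "\<bar>cos (v * (y - x))\<bar> \<le> 1 - min 1 ((v * s)\<^sup>2) / 128" .
  qed
qed

section \<open>Gaps of a strictly increasing sequence\<close>

lemma consecutive_points:
  fixes t :: "nat \<Rightarrow> real"
  assumes mono: "strict_mono_on {1..} t"
    and p: "t ` {1..} \<inter> {a..<b} = {t p, t q}" "1 \<le> p" "p < q"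
  shows "q = Suc p"
proof (rule ccontr)
  assume "q \<noteq> Suc p"
  then have less: "t p < t (Suc p)" "t (Suc p) < t q"
    using p by (auto intro!: strict_mono_onD[OF mono])
  have "t p \<in> {a..<b}" "t q \<in> {a..<b}" using p by blast+
  then have "t (Suc p) \<in> t ` {1..} \<inter> {a..<b}" using less by auto
  then have "t (Suc p) = t p \<or> t (Suc p) = t q" unfolding p(1) by simp
  with less show False by auto
qed

text \<open>
  A cell is an interval, so two points that are alone in it are consecutive. Which of the two sets is
  visited first does not matter, because the cosine is even.
\<close>

lemma separated_gap:
  fixes t :: "nat \<Rightarrow> real" and A B :: "real set"
  assumes mono: "strict_mono_on {1..} t"
    and fin: "finite (t ` {1..} \<inter> {a..<b})"
    and AB: "A \<subseteq> {a..<b}" "B \<subseteq> {a..<b}" "A \<inter> B = {}"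
    and card: "card (t ` {1..} \<inter> A) = 1" "card (t ` {1..} \<inter> B) = 1"
      "card (t ` {1..} \<inter> ({a..<b} - (A \<union> B))) = 0"
    and sep: "\<And>x y. x \<in> A \<Longrightarrow> y \<in> B \<Longrightarrow> \<bar>cos (v * (y - x))\<bar> \<le> q"
  obtains k where "1 \<le> k" "t k \<in> {a..<b}" "t (Suc k) \<in> {a..<b}" "\<bar>cos (v * (t (Suc k) - t k))\<bar> \<le> q"
proof -
  have "finite (t ` {1..} \<inter> ({a..<b} - (A \<union> B)))" by (rule finite_subset[OF _ fin]) auto
  then have emp: "t ` {1..} \<inter> ({a..<b} - (A \<union> B)) = {}" using card(3) by simp
  obtain x where x: "t ` {1..} \<inter> A = {x}" using card(1) by (auto simp: card_1_singleton_iff)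
  obtain y where y: "t ` {1..} \<inter> B = {y}" using card(2) by (auto simp: card_1_singleton_iff)
  have pts: "t ` {1..} \<inter> {a..<b} = {x, y}" using emp x y AB by blast
  obtain p where p: "1 \<le> p" "x = t p" using x by auto
  obtain r where r: "1 \<le> r" "y = t r" using y by auto
  have xA: "x \<in> A" and yB: "y \<in> B" using x y by auto
  then have "p \<noteq> r" using p r AB by auto
  then consider "p < r" | "r < p" by linarith
  then show ?thesis
  proof cases
    case 1
    have "r = Suc p" using consecutive_points[OF mono _ p(1) 1] pts p r by simp
    then show ?thesis using that[OF p(1)] p(2) r(2) xA yB AB(1,2) sep[OF xA yB] by blast
  next
    case 2
    have "p = Suc r" using consecutive_points[OF mono _ r(1) 2] pts p r by (simp add: insert_commute)
    moreover have "\<bar>cos (v * (x - y))\<bar> = \<bar>cos (v * (y - x))\<bar>"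
      using cos_minus[of "v * (y - x)"] by (simp add: algebra_simps)
    ultimately show ?thesis
      using that[OF r(1)] p(2) r(2) xA yB AB(1,2) sep[OF xA yB] by (metis subsetD)
  qed
qed

text \<open>
  Different cells have different gaps, since a gap found by the preceding lemma starts inside its cell.
  Keeping these factors and bounding all others by \<open>1\<close> replaces the product over the gaps, whose
  number and positions are random, by a product over fixed cells that involves only
  counts of points. The gaps are stopped at \<open>T\<close>, which leaves those inside the cells unchanged.
\<close>

lemma prod_cos_gaps_le:
  fixes t :: "nat \<Rightarrow> real" and A B :: "nat \<Rightarrow> real set"
  assumes mono: "strict_mono_on {1..} t"
    and fin: "\<And>x y. finite (t ` {1..} \<inter> {x..<y})"
    and n: "1 \<le> n" "T < t n"
    and cells: "disjoint_family_on (\<lambda>b. {l b..<u b}) {..<m}" "\<And>b. b < m \<Longrightarrow> u b \<le> T"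
    and AB: "\<And>b. b < m \<Longrightarrow> A b \<subseteq> {l b..<u b} \<and> B b \<subseteq> {l b..<u b} \<and> A b \<inter> B b = {}"
    and sep: "\<And>b x y. b < m \<Longrightarrow> x \<in> A b \<Longrightarrow> y \<in> B b \<Longrightarrow> \<bar>cos (v * (y - x))\<bar> \<le> q"
    and q: "0 \<le> q"
  shows "(\<Prod>k<n. \<bar>cos (v * (min (t (Suc k)) T - min (t k) T))\<bar>)
       \<le> (\<Prod>b<m. if card (t ` {1..} \<inter> A b) = 1 \<and> card (t ` {1..} \<inter> B b) = 1
               \<and> card (t ` {1..} \<inter> ({l b..<u b} - (A b \<union> B b))) = 0 then q else 1)"
    (is "?L \<le> (\<Prod>b<m. if ?D b then q else 1)")
proof -
  define S where "S = {b. b < m \<and> ?D b}"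
  let ?c = "\<lambda>k. \<bar>cos (v * (min (t (Suc k)) T - min (t k) T))\<bar>"
  have "\<exists>k. 1 \<le> k \<and> t k \<in> {l b..<u b} \<and> t (Suc k) \<in> {l b..<u b} \<and> \<bar>cos (v * (t (Suc k) - t k))\<bar> \<le> q"
    if "b \<in> S" for b
  proof -
    have b: "b < m" "?D b" using that by (simp_all add: S_def)
    obtain k where "1 \<le> k" "t k \<in> {l b..<u b}" "t (Suc k) \<in> {l b..<u b}"
        "\<bar>cos (v * (t (Suc k) - t k))\<bar> \<le> q"
      by (rule separated_gap[of t "l b" "u b" "A b" "B b" v q])
         (use mono fin AB[OF b(1)] sep[OF b(1)] b(2) in simp_all)
    then show ?thesis by blast
  qed
  \<comment> \<open>An injective choice of gaps, one for each cell with the favourable pattern.\<close>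
  then obtain \<kappa> where \<kappa>: "\<And>b. b \<in> S \<Longrightarrow> 1 \<le> \<kappa> b \<and> t (\<kappa> b) \<in> {l b..<u b} \<and> t (Suc (\<kappa> b)) \<in> {l b..<u b} \<and>
      \<bar>cos (v * (t (Suc (\<kappa> b)) - t (\<kappa> b)))\<bar> \<le> q"
    by metis
  have lt: "\<kappa> b < n" if b: "b \<in> S" for b
  proof (rule ccontr)
    assume "\<not> \<kappa> b < n"
    then have "t n \<le> t (\<kappa> b)"
      using n \<kappa>[OF b] by (intro strict_mono_on_leD[OF mono]) auto
    with \<kappa>[OF b] cells(2)[of b] b n show False by (auto simp: S_def)
  qed
  have inj: "inj_on \<kappa> S"
  proof (rule inj_onI)
    fix b b' assume b: "b \<in> S" "b' \<in> S" "\<kappa> b = \<kappa> b'"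
    then have "t (\<kappa> b) \<in> {l b..<u b} \<inter> {l b'..<u b'}" using \<kappa>[of b] \<kappa>[of b'] by auto
    with cells(1) b show "b = b'" unfolding disjoint_family_on_def S_def by blast
  qed
  have c: "?c (\<kappa> b) \<le> q" if b: "b \<in> S" for b
  proof -
    have "t (\<kappa> b) \<le> T" "t (Suc (\<kappa> b)) \<le> T" using \<kappa>[OF b] cells(2)[of b] b by (auto simp: S_def)
    then show ?thesis using \<kappa>[OF b] by (simp add: min_absorb1)
  qed
  have "?L = (\<Prod>k\<in>{..<n} - \<kappa> ` S. ?c k) * (\<Prod>k\<in>\<kappa> ` S. ?c k)"
    using lt by (intro prod.subset_diff) auto
  also have "\<dots> \<le> 1 * (\<Prod>k\<in>\<kappa> ` S. ?c k)"
    by (intro mult_right_mono prod_le_1 prod_nonneg) auto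
  also have "\<dots> = (\<Prod>b\<in>S. ?c (\<kappa> b))" using inj by (simp add: prod.reindex)
  also have "\<dots> \<le> (\<Prod>b\<in>S. q)" using c by (intro prod_mono) auto
  also have "\<dots> = (\<Prod>b<m. if ?D b then q else 1)"
    using prod.inter_filter[of "{..<m}" "\<lambda>_. q" ?D] unfolding S_def lessThan_iff by simp
  finally show ?thesis .
qed

text \<open>
  The path moves with speed at most one, so between time \<open>T\<close> and the turning time \<open>t n\<close> it moves by at
  most \<open>t n - T\<close>.
\<close>

lemma stopped_sum_close:
  fixes t f :: "nat \<Rightarrow> real"
  assumes t: "t 0 = 0" "\<And>k. t k \<le> t (Suc k)" and T: "0 \<le> T" "T < t n" and f: "\<And>k. \<bar>f k\<bar> \<le> 1"
  shows "\<bar>(\<Sum>k<n. (min (t (Suc k)) T - min (t k) T) * f k) - (\<Sum>k<n. (t (Suc k) - t k) * f k)\<bar> \<le> t n - T"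
proof -
  \<comment> \<open>The part of the time line after T; it is nondecreasing in k and vanishes for k = 0.\<close>
  define h where "h k = t k - min (t k) T" for k
  have h: "h k \<le> h (Suc k)" for k using t(2)[of k] by (auto simp: h_def min_def)
  have "\<bar>(\<Sum>k<n. (min (t (Suc k)) T - min (t k) T) * f k) - (\<Sum>k<n. (t (Suc k) - t k) * f k)\<bar>
      = \<bar>\<Sum>k<n. (h (Suc k) - h k) * f k\<bar>"
    by (subst abs_minus_commute) (simp add: h_def algebra_simps flip: sum_subtractf)
  also have "\<dots> \<le> (\<Sum>k<n. (h (Suc k) - h k) * 1)"
  proof (rule order_trans[OF sum_abs], rule sum_mono)
    fix k show "\<bar>(h (Suc k) - h k) * f k\<bar> \<le> (h (Suc k) - h k) * 1"
      unfolding abs_mult using h[of k] f[of k] by (intro mult_mono) auto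
  qed
  also have "\<dots> = h n - h 0" by (simp add: sum_lessThan_telescope)
  also have "\<dots> = t n - T" using t T by (simp add: h_def)
  finally show ?thesis .
qed

section \<open>Counts of a Poisson process in disjoint sets\<close>

context prob_space
begin

lemma poisson_point_processD:
  assumes "poisson_point_process lam pts" "A \<in> sets borel" "bounded A" "A \<subseteq> {0..}"
  shows "random_variable (count_space UNIV) (\<lambda>w. card (pts w \<inter> A))"
    and "prob {w \<in> space M. card (pts w \<inter> A) = k}
          = (LINT t:A|lborel. lam t) ^ k / fact k * exp (- (LINT t:A|lborel. lam t))"
  using assms unfolding poisson_point_process_def poisson_variable_def by blast+

text \<open>
  The disjoint sets come in triples \<open>Z (3b), Z (3b+1), Z (3b+2)\<close>, followed by one last set
  \<open>Z (3m)\<close>. Grouping independent counts keeps them independent, so the expectation of the product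
  factorizes over the triples; within a triple, the probability of the counts \<open>(1, 1, 0)\<close> is again a
  product. A triple will consist of two subsets of a time cell and of the rest of that cell, so
  that the counts \<open>(1, 1, 0)\<close> say that the cell has one point in each of the two subsets and no other.
\<close>

lemma expectation_poisson_cells:
  fixes Z :: "nat \<Rightarrow> real set" and q :: real and m :: nat
  assumes ppp: "poisson_point_process lam pts"
    and Z: "\<And>i. i < 3 * m + 1 \<Longrightarrow> Z i \<in> sets borel \<and> bounded (Z i) \<and> Z i \<subseteq> {0..}"
    and disj: "disjoint_family_on Z {..<3 * m + 1}"
  defines "N \<equiv> \<lambda>i w. card (pts w \<inter> Z i)"
    and "\<mu> \<equiv> \<lambda>i. LINT t:Z i|lborel. lam t"
  shows "expectation (\<lambda>w. (if N (3 * m) w = 0 then 0 else 1) *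
            (\<Prod>b<m. if N (3 * b) w = 1 \<and> N (3 * b + 1) w = 1 \<and> N (3 * b + 2) w = 0 then q else 1))
       = (1 - exp (- \<mu> (3 * m))) *
            (\<Prod>b<m. 1 - (1 - q) * (\<mu> (3 * b) * \<mu> (3 * b + 1) *
               exp (- (\<mu> (3 * b) + \<mu> (3 * b + 1) + \<mu> (3 * b + 2)))))"
proof -
  define K where "K b = (if b < m then {3 * b, 3 * b + 1, 3 * b + 2} else {3 * m})" for b
  define D where "D b w \<longleftrightarrow> N (3 * b) w = 1 \<and> N (3 * b + 1) w = 1 \<and> N (3 * b + 2) w = 0" for b w
  define Y where "Y b x = (if b < m
      then if x (3 * b) = 1 \<and> x (3 * b + 1) = 1 \<and> x (3 * b + 2) = 0 then q else 1
      else if x (3 * m) = 0 then 0 else 1 :: real)" for b and x :: "nat \<Rightarrow> nat"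
  define X where "X b w = (if b < m then if D b w then q else 1
      else if N (3 * m) w = 0 then 0 else 1 :: real)" for b w
  have N_meas [measurable]: "N i \<in> M \<rightarrow>\<^sub>M count_space UNIV" if "i < 3 * m + 1" for i
    using poisson_point_processD(1)[OF ppp] Z[OF that] unfolding N_def by blast
  have N_prob: "prob {w \<in> space M. N i w = k} = \<mu> i ^ k / fact k * exp (- \<mu> i)" if "i < 3 * m + 1" for i k
    using poisson_point_processD(2)[OF ppp] Z[OF that] unfolding N_def \<mu>_def by blast
  have N_indep: "indep_vars (\<lambda>_. count_space UNIV) N {..<3 * m + 1}"
    using ppp Z disj unfolding poisson_point_process_def N_def by blast
  have "indep_vars (\<lambda>b. Pi\<^sub>M (K b) (\<lambda>_. count_space UNIV)) (\<lambda>b w. \<lambda>i\<in>K b. N i w) {..m}"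
  proof (rule indep_vars_restrict[OF N_indep])
    show "disjoint_family_on K {..m}"
      by (auto simp: disjoint_family_on_def K_def; presburger)
  qed (auto simp: K_def split: if_splits)
  then have "indep_vars (\<lambda>_. borel) (\<lambda>b w. Y b (\<lambda>i\<in>K b. N i w)) {..m}"
  proof (rule indep_vars_compose2)
    fix b assume "b \<in> {..m}"
    show "Y b \<in> Pi\<^sub>M (K b) (\<lambda>_. count_space UNIV) \<rightarrow>\<^sub>M borel"
    proof (cases "b < m")
      case True
      have [measurable]: "(\<lambda>x. x i) \<in> Pi\<^sub>M (K b) (\<lambda>_. count_space UNIV) \<rightarrow>\<^sub>M count_space UNIV"
        if "i \<in> {3 * b, 3 * b + 1, 3 * b + 2}" for i
        using that True by (intro measurable_component_singleton) (auto simp: K_def)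
      show ?thesis unfolding Y_def using True by simp
    next
      case False
      have [measurable]: "(\<lambda>x. x (3 * m)) \<in> Pi\<^sub>M (K b) (\<lambda>_. count_space UNIV) \<rightarrow>\<^sub>M count_space UNIV"
        using False by (intro measurable_component_singleton) (auto simp: K_def)
      show ?thesis unfolding Y_def using False by simp
    qed
  qed
  moreover have "Y b (\<lambda>i\<in>K b. N i w) = X b w" if "b \<le> m" for b w
    using that by (auto simp: X_def Y_def K_def D_def)
  ultimately have X_indep: "indep_vars (\<lambda>_. borel) X {..m}"
    by (subst indep_vars_cong[where Y = "\<lambda>b w. Y b (\<lambda>i\<in>K b. N i w)" and J = "{..m}" and N' = "\<lambda>_. borel"]) auto
  have X_int: "integrable M (X b)" if "b \<le> m" for b
  proof (rule integrable_const_bound[where B = "max \<bar>q\<bar> 1"])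
    show "random_variable borel (X b)" using X_indep that by (auto simp: indep_vars_def)
  qed (auto simp: X_def)
  have D_event: "{w \<in> space M. D b w} \<in> events" if "b < m" for b
    unfolding D_def using that by simp
  have D_int: "integrable M (indicat_real {w \<in> space M. D b w})" if "b < m" for b
    using D_event[OF that] by (intro integrable_const_bound[where B = 1]) (auto simp: indicator_def)
  have D_prob: "prob {w \<in> space M. D b w} = \<mu> (3 * b) * \<mu> (3 * b + 1) *
               exp (- (\<mu> (3 * b) + \<mu> (3 * b + 1) + \<mu> (3 * b + 2)))" if "b < m" for b
  proof -
    define v :: "nat \<Rightarrow> nat" where "v i = (if i = 3 * b + 2 then 0 else 1)" for i
    have "{w \<in> space M. D b w} = (\<Inter>i\<in>{3 * b, 3 * b + 1, 3 * b + 2}. N i -` {v i} \<inter> space M)"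
      by (auto simp: D_def v_def)
    also have "prob \<dots> = (\<Prod>i\<in>{3 * b, 3 * b + 1, 3 * b + 2}. prob (N i -` {v i} \<inter> space M))"
      using that by (intro indep_varsD[OF N_indep]) auto
    also have "\<dots> = (\<Prod>i\<in>{3 * b, 3 * b + 1, 3 * b + 2}. prob {w \<in> space M. N i w = v i})"
      by (intro prod.cong arg_cong[where f = prob]) auto
    also have "\<dots> = (\<Prod>i\<in>{3 * b, 3 * b + 1, 3 * b + 2}. \<mu> i ^ v i / fact (v i) * exp (- \<mu> i))"
      using that by (intro prod.cong refl N_prob) auto
    finally show ?thesis by (simp add: v_def exp_add exp_diff exp_minus field_simps)
  qed
  have EX: "expectation (X b) = 1 - (1 - q) * (\<mu> (3 * b) * \<mu> (3 * b + 1) *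
               exp (- (\<mu> (3 * b) + \<mu> (3 * b + 1) + \<mu> (3 * b + 2))))" if "b < m" for b
  proof -
    have "expectation (X b) = expectation (\<lambda>w. 1 - (1 - q) * indicator {w \<in> space M. D b w} w)"
      using that by (intro Bochner_Integration.integral_cong) (auto simp: X_def)
    also have "\<dots> = 1 - (1 - q) * prob {w \<in> space M. D b w}"
      using D_event[OF that] D_int[OF that] by (subst Bochner_Integration.integral_diff) (auto simp: prob_space)
    finally show ?thesis by (simp add: D_prob[OF that])
  qed
  have "expectation (X m) = expectation (\<lambda>w. 1 - indicator {w \<in> space M. N (3 * m) w = 0} w)"
    by (intro Bochner_Integration.integral_cong) (auto simp: X_def)
  also have "\<dots> = 1 - prob {w \<in> space M. N (3 * m) w = 0}"
    by (subst Bochner_Integration.integral_diff)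
       (auto simp: prob_space intro!: integrable_const_bound[where B = 1])
  finally have EXm: "expectation (X m) = 1 - exp (- \<mu> (3 * m))"
    by (simp add: N_prob)
  have "expectation (\<lambda>w. \<Prod>b\<le>m. X b w) = (\<Prod>b\<le>m. expectation (X b))"
    using X_indep X_int by (intro indep_vars_lebesgue_integral) auto
  also have "{..m} = insert m {..<m}" by auto
  finally show ?thesis
    by (simp add: EX EXm) (simp add: X_def D_def)
qed
end

section \<open>Averaging over the signs\<close>

lemma signed_unit_vectors_real: "signed_unit_vectors = {1, -1 :: real}"
  by (auto simp: signed_unit_vectors_def Basis_real_def)

locale linear_conservative_walk = orthogonal_conservative_walk M lam tau f
  for M :: "'a measure" and lam :: "real \<Rightarrow> real"
    and tau :: "nat \<Rightarrow> 'a \<Rightarrow> real" and f :: "nat \<Rightarrow> 'a \<Rightarrow> real"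
begin

text \<open>
  The sign symmetry makes the characteristic function real. Frequency \<open>1\<close> suffices because the
  coefficient \<open>c\<close> can absorb any other one.
\<close>

lemma char_scaled_sign: "char (distr M borel (\<lambda>w. c * f k w)) 1 = complex_of_real (cos c)"
proof -
  note f_measurable[measurable]
  have "char (distr M borel (\<lambda>w. c * f k w)) 1 = (CLINT w|M. iexp (c * f k w))"
    unfolding char_def by (subst integral_distr) auto
  also have "\<dots> = (CLINT x|distr M borel (f k). iexp (c * x))"
    by (subst integral_distr) auto
  also have "\<dots> = (CLINT x|distr (measure_pmf (pmf_of_set {1, -1 :: real})) borel (\<lambda>v. v). iexp (c * x))"
    unfolding f_uniform signed_unit_vectors_real ..
  also have "\<dots> = (CLINT x|measure_pmf (pmf_of_set {1, -1 :: real}). iexp (c * x))"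
    by (subst integral_distr) auto
  also have "\<dots> = (\<Sum>x\<in>{1, -1 :: real}. pmf (pmf_of_set {1, -1 :: real}) x *\<^sub>R iexp (c * x))"
    by (rule integral_measure_pmf) auto
  also have "\<dots> = complex_of_real (cos c)"
    by (simp add: complex_eq_iff Re_exp Im_exp)
  finally show ?thesis .
qed

lemma expectation_cos_signed_sum:
  "expectation (\<lambda>w. cos (\<Sum>k<n. c k * f k w)) = (\<Prod>k<n. cos (c k))"
proof -
  note f_measurable[measurable]
  have "indep_vars (\<lambda>_. borel) (\<lambda>k w. c k * f k w) {..<n}"
    by (rule indep_vars_compose2[where Y = "\<lambda>k x. c k * x", OF indep_vars_subset[OF f_indep]]) auto
  then have "char (distr M borel (\<lambda>w. \<Sum>k<n. c k * f k w)) 1 = (\<Prod>k<n. complex_of_real (cos (c k)))"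
    by (subst char_distr_sum) (simp_all add: char_scaled_sign)
  moreover have "char (distr M borel (\<lambda>w. \<Sum>k<n. c k * f k w)) 1
      = (CLINT w|M. iexp (\<Sum>k<n. c k * f k w))"
    unfolding char_def by (subst integral_distr) auto
  moreover have "Re (CLINT w|M. iexp (\<Sum>k<n. c k * f k w))
      = (LINT w|M. Re (iexp (\<Sum>k<n. c k * f k w)))"
    by (rule integral_Re[symmetric], rule integrable_const_bound[where B = 1]) auto
  ultimately have "(LINT w|M. Re (iexp (\<Sum>k<n. c k * f k w))) = Re (\<Prod>k<n. complex_of_real (cos (c k)))"
    by simp
  then show ?thesis by (simp add: Re_exp flip: of_real_prod)
qed

text \<open>
  The two sequences as single random elements of product spaces. The index set of \<open>tau_seq\<close> starts at
  \<open>1\<close>, as in the independence assumption of the model; the constant \<open>tau 0\<close> is supplied separately.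
\<close>

definition f_seq :: "'a \<Rightarrow> nat \<Rightarrow> real" where
  "f_seq w = (\<lambda>k\<in>UNIV. f k w)"

definition tau_seq :: "'a \<Rightarrow> nat \<Rightarrow> real" where
  "tau_seq w = (\<lambda>k\<in>{1..}. tau k w)"

lemma f_seq_measurable [measurable]: "f_seq \<in> M \<rightarrow>\<^sub>M Pi\<^sub>M UNIV (\<lambda>_. borel)"
  unfolding f_seq_def by (rule measurable_restrict) (rule f_measurable)

lemma tau_seq_measurable [measurable]: "tau_seq \<in> M \<rightarrow>\<^sub>M Pi\<^sub>M {1..} (\<lambda>_. borel)"
  unfolding tau_seq_def by (rule measurable_restrict) (rule tau_measurable)

lemma indep_f_seq_tau_seq:
  "indep_var (Pi\<^sub>M UNIV (\<lambda>_. borel)) f_seq (Pi\<^sub>M {1..} (\<lambda>_. borel)) tau_seq"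
  using f_tau_indep unfolding indep_var_eq sets_vimage_algebra f_seq_def[abs_def] tau_seq_def[abs_def]
  using f_seq_measurable tau_seq_measurable unfolding f_seq_def[abs_def] tau_seq_def[abs_def] by auto

text \<open>
  The conditional expectation given the turning times, in integrated form: the joint law of signs and
  times is a product measure, so by Fubini the coefficients may be frozen while the signs are averaged.
  The weight \<open>h\<close> will be the indicator of an event that depends on the times only.
\<close>

lemma expectation_cos_given_times:
  fixes h :: "(nat \<Rightarrow> real) \<Rightarrow> real" and c :: "nat \<Rightarrow> (nat \<Rightarrow> real) \<Rightarrow> real"
  assumes [measurable]: "h \<in> borel_measurable (Pi\<^sub>M {1..} (\<lambda>_. borel))"
    and [measurable]: "\<And>k. c k \<in> borel_measurable (Pi\<^sub>M {1..} (\<lambda>_. borel))"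
    and bound: "\<And>y. \<bar>h y\<bar> \<le> 1"
  shows "expectation (\<lambda>w. h (tau_seq w) * cos (\<Sum>k<n. c k (tau_seq w) * f k w))
       = expectation (\<lambda>w. h (tau_seq w) * (\<Prod>k<n. cos (c k (tau_seq w))))"
proof -
  let ?F = "Pi\<^sub>M UNIV (\<lambda>_. borel) :: (nat \<Rightarrow> real) measure"
  let ?T = "Pi\<^sub>M {1..} (\<lambda>_. borel) :: (nat \<Rightarrow> real) measure"
  let ?DF = "distr M ?F f_seq" and ?DT = "distr M ?T tau_seq"
  let ?g = "\<lambda>x y. h y * cos (\<Sum>k<n. c k y * x k)"
  note One_nat_def [simp del]
  interpret F: prob_space ?DF by (rule prob_space_distr) simp
  interpret T: prob_space ?DT by (rule prob_space_distr) (rule tau_seq_measurable)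
  interpret P: pair_prob_space ?DF ?DT ..
  have joint: "?DF \<Otimes>\<^sub>M ?DT = distr M (?F \<Otimes>\<^sub>M ?T) (\<lambda>w. (f_seq w, tau_seq w))"
    using indep_f_seq_tau_seq by (simp add: indep_var_distribution_eq)
  have meas [measurable]: "case_prod ?g \<in> borel_measurable (?F \<Otimes>\<^sub>M ?T)"
    by measurable
  have "expectation (\<lambda>w. h (tau_seq w) * cos (\<Sum>k<n. c k (tau_seq w) * f k w))
      = expectation (\<lambda>w. case_prod ?g (f_seq w, tau_seq w))"
    by (simp add: f_seq_def)
  also have "\<dots> = (LINT z|(?DF \<Otimes>\<^sub>M ?DT). case_prod ?g z)"
    unfolding joint by (subst integral_distr) (auto simp: case_prod_beta)
  also have "\<dots> = (LINT y|?DT. LINT x|?DF. ?g x y)"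
  proof (rule P.integral_snd[symmetric], rule P.integrable_const_bound[where B = 1])
    show "AE z in ?DF \<Otimes>\<^sub>M ?DT. norm (case_prod ?g z) \<le> 1"
    proof (rule AE_I2, clarify)
      fix x y
      show "norm (?g x y) \<le> 1"
        using bound[of y] by (simp add: abs_mult mult_le_one)
    qed
    show "case_prod ?g \<in> borel_measurable (?DF \<Otimes>\<^sub>M ?DT)" by measurable
  qed
  also have "\<dots> = (LINT y|?DT. h y * (\<Prod>k<n. cos (c k y)))"
  proof (rule Bochner_Integration.integral_cong[OF refl])
    fix y
    have "(LINT x|?DF. ?g x y) = expectation (\<lambda>w. h y * cos (\<Sum>k<n. c k y * f_seq w k))"
      by (subst integral_distr) auto
    also have "\<dots> = h y * (\<Prod>k<n. cos (c k y))"
      using expectation_cos_signed_sum[of "\<lambda>k. c k y" n] by (simp add: f_seq_def)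
    finally show "(LINT x|?DF. ?g x y) = h y * (\<Prod>k<n. cos (c k y))" .
  qed
  also have "\<dots> = expectation (\<lambda>w. h (tau_seq w) * (\<Prod>k<n. cos (c k (tau_seq w))))"
    by (subst integral_distr) auto
  finally show ?thesis .
qed

end

section \<open>The position of the path at a fixed time\<close>

context linear_conservative_walk
begin

text \<open>
  The position at time \<open>T\<close> of the continuous path whose value at the \<open>n\<close>-th turning time is the
  embedded process, provided that the \<open>n\<close>-th turning time is later than \<open>T\<close>.
\<close>

definition stopped_walk :: "real \<Rightarrow> nat \<Rightarrow> 'a \<Rightarrow> real" where
  "stopped_walk T n w = (\<Sum>k<n. (min (tau (Suc k) w) T - min (tau k w) T) * f k w)"

text \<open>
  The second condition makes the choice of \<open>n\<close> immaterial: once it holds, almost surely increasing \<open>n\<close> does not change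
  \<open>stopped_walk T n\<close>. A fixed \<open>n\<close> is what allows the signs to be averaged.
\<close>

definition turn_after :: "real \<Rightarrow> nat \<Rightarrow> 'a set" where
  "turn_after T n = {w \<in> space M. (\<exists>k\<ge>1. tau k w \<in> {T<..T + 1}) \<and> T < tau n w}"

lemma turn_after_event [measurable]: "turn_after T n \<in> events"
proof -
  note tau_measurable [measurable]
  show ?thesis unfolding turn_after_def by measurable
qed

lemma stopped_walk_measurable [measurable]: "stopped_walk T n \<in> borel_measurable M"
proof -
  note tau_measurable [measurable] f_measurable [measurable]
  show ?thesis unfolding stopped_walk_def[abs_def] by measurable
qed

text \<open>
  Averaging over the signs gives a product of cosines of gaps; this is at most a product over cells,
  which is a function of counts in disjoint sets. The interval \<open>{T<..T + 1}\<close> lies after all the cells,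
  so the event that it contains a turning time contributes an independent factor. It is essential that
  this factor is kept: the sum over \<open>T\<close> would not converge without it.
\<close>

lemma expectation_cos_stopped_le:
  fixes l u :: "nat \<Rightarrow> real" and A B :: "nat \<Rightarrow> real set" and q v T :: real
  defines "\<mu> \<equiv> \<lambda>S. LINT t:S|lborel. lam t"
  assumes n: "1 \<le> n" and T: "0 \<le> T"
    and cells: "disjoint_family_on (\<lambda>b. {l b..<u b}) {..<m}" "\<And>b. b < m \<Longrightarrow> 0 \<le> l b \<and> u b \<le> T"
    and AB: "\<And>b. b < m \<Longrightarrow> A b \<subseteq> {l b..<u b} \<and> B b \<subseteq> {l b..<u b} \<and> A b \<inter> B b = {}"
    and borel: "\<And>b. b < m \<Longrightarrow> A b \<in> sets borel \<and> B b \<in> sets borel"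
    and sep: "\<And>b x y. b < m \<Longrightarrow> x \<in> A b \<Longrightarrow> y \<in> B b \<Longrightarrow> \<bar>cos (v * (y - x))\<bar> \<le> q"
    and q: "0 \<le> q" "q \<le> 1"
  shows "expectation (\<lambda>w. indicator (turn_after T n) w * cos (v * stopped_walk T n w))
     \<le> (1 - exp (- \<mu> {T<..T + 1})) * (\<Prod>b<m. 1 - (1 - q) * (\<mu> (A b) * \<mu> (B b) *
           exp (- (\<mu> (A b) + \<mu> (B b) + \<mu> ({l b..<u b} - (A b \<union> B b))))))"
proof -
  note tau_measurable [measurable] f_measurable [measurable]
  define pts where "pts w = (\<lambda>k. tau k w) ` {1..}" for w
  define Z where "Z i = (if i = 3 * m then {T<..T + 1} else if i mod 3 = 0 then A (i div 3)
      else if i mod 3 = 1 then B (i div 3) else {l (i div 3)..<u (i div 3)} - (A (i div 3) \<union> B (i div 3)))" for i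
  define N where "N i w = card (pts w \<inter> Z i)" for i w
  have Z_simps: "Z (3 * m) = {T<..T + 1}" "b < m \<Longrightarrow> Z (3 * b) = A b" "b < m \<Longrightarrow> Z (3 * b + 1) = B b"
      "b < m \<Longrightarrow> Z (3 * b + 2) = {l b..<u b} - (A b \<union> B b)" for b
  proof -
    have "(3 * b) mod 3 = 0" "(3 * b) div 3 = b" "(3 * b + 1) mod 3 = 1" "(3 * b + 1) div 3 = b"
      "(3 * b + 2) mod 3 = 2" "(3 * b + 2) div 3 = b" "3 * b + 1 \<noteq> 3 * m" "3 * b + 2 \<noteq> 3 * m"
      by presburger+
    then show "Z (3 * m) = {T<..T + 1}" "b < m \<Longrightarrow> Z (3 * b) = A b" "b < m \<Longrightarrow> Z (3 * b + 1) = B b"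
      "b < m \<Longrightarrow> Z (3 * b + 2) = {l b..<u b} - (A b \<union> B b)"
      unfolding Z_def by simp_all
  qed
  have Z_sub: "Z i \<subseteq> {l (i div 3)..<u (i div 3)}" "i div 3 < m" if "i < 3 * m" for i
  proof -
    show m: "i div 3 < m" using that by presburger
    show "Z i \<subseteq> {l (i div 3)..<u (i div 3)}" using that AB[OF m] by (auto simp: Z_def)
  qed
  have disj: "disjoint_family_on Z {..<3 * m + 1}"
  proof (unfold disjoint_family_on_def, intro ballI impI)
    have *: "Z i \<inter> Z i' = {}" if "i < i'" "i' < 3 * m + 1" for i i'
    proof (cases "i' = 3 * m")
      case True
      then have "Z i \<subseteq> {l (i div 3)..<u (i div 3)}" "i div 3 < m" using Z_sub[of i] that by auto
      then show ?thesis using cells(2)[of "i div 3"] True by (auto simp: Z_simps(1))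
    next
      case False
      then have i: "i < 3 * m" "i' < 3 * m" using that by auto
      show ?thesis
      proof (cases "i div 3 = i' div 3")
        case True
        have "i mod 3 \<noteq> i' mod 3" using True that(1) by (metis div_mod_decomp less_irrefl)
        moreover have "i' mod 3 < 3" "i mod 3 < 3" by simp_all
        ultimately show ?thesis using AB[OF Z_sub(2)[OF i(1)]] i True by (auto simp: Z_def split: if_splits)
      next
        case False
        then have "{l (i div 3)..<u (i div 3)} \<inter> {l (i' div 3)..<u (i' div 3)} = {}"
          using cells(1) Z_sub(2)[OF i(1)] Z_sub(2)[OF i(2)] unfolding disjoint_family_on_def by blast
        then show ?thesis using Z_sub(1)[OF i(1)] Z_sub(1)[OF i(2)] by blast
      qed
    qed
    fix i i' assume "i \<in> {..<3 * m + 1}" "i' \<in> {..<3 * m + 1}" "i \<noteq> i'"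
    then show "Z i \<inter> Z i' = {}" using *[of i i'] *[of i' i] by (cases "i < i'") (auto simp: Int_commute)
  qed
  have Z: "Z i \<in> sets borel \<and> bounded (Z i) \<and> Z i \<subseteq> {0..}" if "i < 3 * m + 1" for i
  proof (cases "i = 3 * m")
    case True
    then show ?thesis using T by (auto simp: Z_simps(1))
  next
    case False
    then have i: "i < 3 * m" using that by simp
    have "Z i \<in> sets borel" using borel[OF Z_sub(2)[OF i]] by (auto simp: Z_def)
    moreover have "bounded (Z i)" by (rule bounded_subset[OF _ Z_sub(1)[OF i]]) simp
    ultimately show ?thesis using Z_sub(1)[OF i] cells(2)[OF Z_sub(2)[OF i]] by force
  qed
  have ppp: "poisson_point_process lam pts" using tau_poisson unfolding pts_def .
  have N_meas [measurable]: "N i \<in> M \<rightarrow>\<^sub>M count_space UNIV" if "i < 3 * m + 1" for i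
    using poisson_point_processD(1)[OF ppp] Z[OF that] unfolding N_def by blast
  define F where "F w = (if N (3 * m) w = 0 then 0 else 1) *
            (\<Prod>b<m. if N (3 * b) w = 1 \<and> N (3 * b + 1) w = 1 \<and> N (3 * b + 2) w = 0 then q else 1)" for w
  define h where "h y = indicat_real {y. (\<exists>k\<ge>1. y k \<in> {T<..T + 1}) \<and> T < y n} y" for y :: "nat \<Rightarrow> real"
  \<comment> \<open>The value at index 0 is tau 0 = 0; the sequence y carries no information there.\<close>
  define c where "c k y = v * (min (y (Suc k)) T - min (if k = 0 then 0 else y k) T)" for k and y :: "nat \<Rightarrow> real"
  have comp [measurable]: "(\<lambda>y. y k) \<in> borel_measurable (Pi\<^sub>M {1..} (\<lambda>_. borel))" if "k \<ge> 1" for k :: nat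
    using that by (intro measurable_component_singleton) auto
  have h_eq: "h (tau_seq w) = indicator (turn_after T n) w" if "w \<in> space M" for w
    using that n by (auto simp: h_def tau_seq_def turn_after_def indicator_def)
  have c_eq: "c k (tau_seq w) = v * (min (tau (Suc k) w) T - min (tau k w) T)" if "w \<in> space M" for w k
    using tau_0[OF that] by (auto simp: c_def tau_seq_def)
  have "expectation (\<lambda>w. indicator (turn_after T n) w * cos (v * stopped_walk T n w))
      = expectation (\<lambda>w. h (tau_seq w) * cos (\<Sum>k<n. c k (tau_seq w) * f k w))"
    by (intro Bochner_Integration.integral_cong refl)
       (simp add: h_eq c_eq stopped_walk_def sum_distrib_left mult.assoc)
  also have "\<dots> = expectation (\<lambda>w. h (tau_seq w) * (\<Prod>k<n. cos (c k (tau_seq w))))"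
  proof (rule expectation_cos_given_times)
    have "Measurable.pred (Pi\<^sub>M {1..} (\<lambda>_. borel)) (\<lambda>y. (\<exists>k\<in>{1..}. y k \<in> {T<..T + 1}) \<and> T < y n)"
      using n by (intro pred_intros_logic pred_intros_countable_bounded) auto
    then show "h \<in> borel_measurable (Pi\<^sub>M {1..} (\<lambda>_. borel))"
      unfolding h_def[abs_def] by (auto simp: Bex_def atLeast_iff conj_commute)
    show "c k \<in> borel_measurable (Pi\<^sub>M {1..} (\<lambda>_. borel))" for k
      unfolding c_def[abs_def] by (cases "k = 0") auto
  qed (auto simp: h_def)
  also have "\<dots> = expectation (\<lambda>w. indicator (turn_after T n) w *
      (\<Prod>k<n. cos (v * (min (tau (Suc k) w) T - min (tau k w) T))))"
    by (intro Bochner_Integration.integral_cong refl) (simp add: h_eq c_eq)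
  also have "\<dots> \<le> expectation F"
  proof (rule integral_mono_AE)
    show "integrable M (\<lambda>w. indicator (turn_after T n) w *
      (\<Prod>k<n. cos (v * (min (tau (Suc k) w) T - min (tau k w) T))))"
    proof (rule integrable_const_bound[where B = 1])
      show "AE w in M. norm (indicator (turn_after T n) w *
          (\<Prod>k<n. cos (v * (min (tau (Suc k) w) T - min (tau k w) T)))) \<le> 1"
        by (intro AE_I2) (auto simp: indicator_def abs_prod intro!: prod_le_1)
    qed measurable
    show "integrable M F"
    proof (rule integrable_const_bound[where B = 1])
      show "AE w in M. norm (F w) \<le> 1"
        using q by (intro AE_I2) (auto simp: F_def abs_prod intro!: prod_le_1)
      show "F \<in> borel_measurable M"
        unfolding F_def[abs_def]
      proof (intro borel_measurable_times borel_measurable_prod measurable_If borel_measurable_const)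
        show "{w \<in> space M. N (3 * m) w = 0} \<in> events" by simp
        fix b assume "b \<in> {..<m}"
        then show "{w \<in> space M. N (3 * b) w = 1 \<and> N (3 * b + 1) w = 1 \<and> N (3 * b + 2) w = 0} \<in> events"
          by simp
      qed
    qed
    have "AE w in M. w \<in> space M" by (rule AE_space)
    moreover have "AE w in M. pts w \<subseteq> {0..} \<and> (\<forall>T. finite (pts w \<inter> {0..T}))"
      using ppp unfolding poisson_point_process_def by blast
    ultimately show "AE w in M. indicator (turn_after T n) w *
      (\<Prod>k<n. cos (v * (min (tau (Suc k) w) T - min (tau k w) T))) \<le> F w"
      using tau_increasing
    proof eventually_elim
      case (elim w)
      show ?case
      proof (cases "w \<in> turn_after T n")
        case False
        then show ?thesis using q by (auto simp: F_def intro!: prod_nonneg)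
      next
        case True
        have fin: "finite (pts w \<inter> {x..<y})" for x y
          by (rule finite_subset[of _ "pts w \<inter> {0..y}"]) (use elim in auto)
        have "finite (pts w \<inter> {T<..T + 1})"
          by (rule finite_subset[of _ "pts w \<inter> {0..T + 1}"]) (use elim in auto)
        moreover have "pts w \<inter> {T<..T + 1} \<noteq> {}"
          using True by (auto simp: turn_after_def pts_def)
        ultimately have N0: "N (3 * m) w \<noteq> 0" by (simp add: N_def Z_simps(1))
        have "(\<Prod>k<n. cos (v * (min (tau (Suc k) w) T - min (tau k w) T)))
            \<le> (\<Prod>k<n. \<bar>cos (v * (min (tau (Suc k) w) T - min (tau k w) T))\<bar>)"
          unfolding abs_prod[symmetric] by (rule abs_ge_self)
        also have "\<dots> \<le> (\<Prod>b<m. if card (pts w \<inter> A b) = 1 \<and> card (pts w \<inter> B b) = 1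
               \<and> card (pts w \<inter> ({l b..<u b} - (A b \<union> B b))) = 0 then q else 1)"
          unfolding pts_def
          using True elim fin cells AB sep q n
          by (intro prod_cos_gaps_le) (auto simp: turn_after_def pts_def)
        also have "\<dots> = F w"
          using N0 by (simp add: F_def N_def Z_simps Z_simps(3,4)[simplified])
        finally show ?thesis using True by simp
      qed
    qed
  qed
  also have "\<dots> = (1 - exp (- \<mu> (Z (3 * m)))) *
            (\<Prod>b<m. 1 - (1 - q) * (\<mu> (Z (3 * b)) * \<mu> (Z (3 * b + 1)) *
               exp (- (\<mu> (Z (3 * b)) + \<mu> (Z (3 * b + 1)) + \<mu> (Z (3 * b + 2))))))"
    unfolding F_def[abs_def] N_def \<mu>_def by (rule expectation_poisson_cells[OF ppp Z disj])
  finally show ?thesis by (simp add: Z_simps Z_simps(3,4)[simplified])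
qed

definition near_origin :: "real \<Rightarrow> real \<Rightarrow> nat \<Rightarrow> 'a set" where
  "near_origin R T n = {w \<in> turn_after T n. \<bar>stopped_walk T n w\<bar> \<le> R}"

lemma near_origin_event [measurable]: "near_origin R T n \<in> events"
proof -
  have "near_origin R T n = turn_after T n \<inter> {w \<in> space M. \<bar>stopped_walk T n w\<bar> \<le> R}"
    using sets.sets_into_space[OF turn_after_event] by (auto simp: near_origin_def)
  then show ?thesis by simp
qed

text \<open>
  The Fejer majorant of the indicator of \<open>\<bar>X\<bar> \<le> R\<close>, integrated over the probability space.
\<close>

lemma prob_near_origin_le_integral:
  assumes R: "R > 0"
    and G: "set_integrable lborel {0..1} G"
    and le: "\<And>u. u \<in> {0..1} \<Longrightarrow>
      expectation (\<lambda>w. indicator (turn_after T n) w * cos (u / R * stopped_walk T n w)) \<le> G u"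
    and G_nonneg: "\<And>u. u \<in> {0..1} \<Longrightarrow> 0 \<le> G u"
  shows "prob (near_origin R T n) \<le> 4 * (LINT u:{0..1}|lborel. G u)"
proof -
  let ?E = "\<lambda>w. indicator (turn_after T n) w :: real"
  let ?X = "stopped_walk T n"
  let ?g = "\<lambda>w u. ?E w * (indicator {0..1} u * ((1 - u) * cos (u * (?X w / R))))"
  interpret P: pair_sigma_finite M lborel ..
  have int: "integrable (M \<Otimes>\<^sub>M lborel) (case_prod ?g)"
  proof (rule Bochner_Integration.integrable_bound)
    show "integrable (M \<Otimes>\<^sub>M lborel) (indicator (space M \<times> {0..1::real}) :: _ \<Rightarrow> real)"
    proof (rule integrable_real_indicator)
      have "emeasure (M \<Otimes>\<^sub>M lborel) (space M \<times> {0..1::real}) = 1"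
        by (subst lborel.emeasure_pair_measure_Times) (auto simp: emeasure_space_1)
      then show "emeasure (M \<Otimes>\<^sub>M lborel) (space M \<times> {0..1::real}) < \<infinity>" by simp
    qed auto
    show "case_prod ?g \<in> borel_measurable (M \<Otimes>\<^sub>M lborel)"
      by measurable
    show "AE z in M \<Otimes>\<^sub>M lborel. norm (case_prod ?g z) \<le> norm (indicator (space M \<times> {0..1::real}) z :: real)"
    proof (rule AE_I2, clarify)
      fix w :: 'a and u :: real assume "(w, u) \<in> space (M \<Otimes>\<^sub>M lborel)"
      then show "norm (?g w u) \<le> norm (indicator (space M \<times> {0..1::real}) (w, u) :: real)"
        by (auto simp: indicator_def space_pair_measure abs_mult intro!: mult_le_one)
    qed
  qed
  have inner: "(LINT u|lborel. ?g w u) = ?E w * (LBINT u:{0..1}. (1 - u) * cos (u * (?X w / R)))" for w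
    by (simp add: set_lebesgue_integral_def)
  have "prob (near_origin R T n) = expectation (indicator (near_origin R T n))" by simp
  also have "\<dots> \<le> expectation (\<lambda>w. 4 * (LINT u|lborel. ?g w u))"
  proof (rule integral_mono)
    show "integrable M (\<lambda>w. 4 * (LINT u|lborel. ?g w u))"
      using P.integrable_fst[OF int] by simp
    show "integrable M (indicat_real (near_origin R T n))"
      by (intro integrable_const_bound[where B = 1]) (auto simp: indicator_def)
    fix w
    show "indicat_real (near_origin R T n) w \<le> 4 * (LINT u|lborel. ?g w u)"
    proof (cases "w \<in> near_origin R T n")
      case True
      then have "\<bar>?X w / R\<bar> \<le> 1" using R by (simp add: near_origin_def)
      from cos_triangle_integral_ge[OF this] show ?thesis
        using True unfolding inner by (simp add: near_origin_def)
    next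
      case False
      then show ?thesis unfolding inner using cos_triangle_integral_nonneg[of "?X w / R"] by simp
    qed
  qed
  also have "\<dots> = 4 * (LINT u|lborel. LINT w|M. ?g w u)"
    using P.Fubini_integral[OF int] by simp
  also have "(LINT u|lborel. LINT w|M. ?g w u) \<le> (LINT u:{0..1}|lborel. G u)"
    unfolding set_lebesgue_integral_def
  proof (rule integral_mono)
    show "integrable lborel (\<lambda>u. LINT w|M. ?g w u)" using P.integrable_snd[OF int] .
    show "integrable lborel (\<lambda>u. indicator {0..1} u *\<^sub>R G u)" using G unfolding set_integrable_def .
    fix u :: real
    show "(LINT w|M. ?g w u) \<le> indicator {0..1} u *\<^sub>R G u"
    proof (cases "u \<in> {0..1}")
      case True
      have "(LINT w|M. ?g w u) = (LINT w|M. (1 - u) * (?E w * cos (u / R * ?X w)))"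
        using True by (intro Bochner_Integration.integral_cong refl) (simp add: mult_ac)
      also have "\<dots> = (1 - u) * expectation (\<lambda>w. ?E w * cos (u / R * ?X w))" by simp
      also have "\<dots> \<le> (1 - u) * G u" using True le[OF True] by (intro mult_left_mono) auto
      also have "\<dots> \<le> 1 * G u" using True G_nonneg[OF True] by (intro mult_right_mono) auto
      finally show ?thesis using True by simp
    qed simp
  qed
  finally show ?thesis by simp
qed

end

section \<open>The local probability for a power rate\<close>

lemma powr_integral_bounds:
  fixes alpha x y :: real
  assumes "0 \<le> alpha" "0 < x" "S \<in> sets borel" "S \<subseteq> {x..y}"
  shows "y powr (- alpha) * measure lborel S \<le> (LINT t:S|lborel. t powr (- alpha))"
    and "(LINT t:S|lborel. t powr (- alpha)) \<le> x powr (- alpha) * measure lborel S"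
proof -
  have fin: "emeasure lborel S < \<infinity>"
    using emeasure_mono[OF assms(4), of lborel] by (auto simp: emeasure_lborel_Icc_eq split: if_splits
      intro: le_less_trans[OF _ ennreal_less_top])
  have int: "set_integrable lborel S (\<lambda>t. t powr (- alpha))"
    using assms by (intro set_integrable_subset[OF borel_integrable_atLeastAtMost'[of x y]])
      (auto intro!: continuous_intros)
  have const: "set_integrable lborel S (\<lambda>_. c)" "(LINT t:S|lborel. c) = c * measure lborel S" for c :: real
    using assms(3) fin by (auto simp: set_integrable_def set_lebesgue_integral_def less_top)
  have le: "y powr (- alpha) \<le> t powr (- alpha)" "t powr (- alpha) \<le> x powr (- alpha)" if "t \<in> S" for t
    using that assms by (auto intro!: powr_mono2')
  show "y powr (- alpha) * measure lborel S \<le> (LINT t:S|lborel. t powr (- alpha))"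
    unfolding const(2)[symmetric] using le by (intro set_integral_mono const int) auto
  show "(LINT t:S|lborel. t powr (- alpha)) \<le> x powr (- alpha) * measure lborel S"
    unfolding const(2)[symmetric] using le by (intro set_integral_mono const int) auto
qed

lemma integral_inverse_one_plus_square_le:
  fixes k :: real
  assumes "k > 0"
  shows "(LINT u:{0..1}|lborel. 1 / (1 + (k * u)\<^sup>2)) \<le> 2 / k"
proof -
  have nz: "1 + (k * u)\<^sup>2 \<noteq> 0" for u :: real by (smt (verit) zero_le_power2)
  have "(LBINT u. indicator {0..1} u *\<^sub>R (1 / (1 + (k * u)\<^sup>2))) = arctan (k * 1) / k - arctan (k * 0) / k"
  proof (rule integral_FTC_Icc[where F = "\<lambda>u. arctan (k * u) / k"])
    fix x
    have "((\<lambda>u. arctan (k * u) / k) has_real_derivative (inverse (1 + (k * x)\<^sup>2) * k) / k) (at x within {0..1})"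
      by (auto intro!: derivative_eq_intros)
    then show "((\<lambda>u. arctan (k * u) / k) has_vector_derivative 1 / (1 + (k * x)\<^sup>2)) (at x within {0..1})"
      using assms by (simp add: has_real_derivative_iff_has_vector_derivative inverse_eq_divide)
  qed (use nz in \<open>auto intro!: continuous_intros\<close>)
  moreover have "arctan k \<le> 2" using arctan_ubound[of k] pi_less_4 by simp
  ultimately show ?thesis using assms by (simp add: set_lebesgue_integral_def divide_right_mono)
qed

context linear_conservative_walk
begin

text \<open>
  Near time \<open>T\<close> the mean gap is of the order \<open>s = T powr alpha\<close>, and this is the cell length to take:
  cells of length \<open>2 s\<close> inside \<open>[T / 2, T]\<close> have expected numbers of points between positive constants,
  so each of them shows the favourable pattern with a probability bounded below. There are about
  \<open>T powr (1 - alpha) / 4\<close> such cells. The prefactor \<open>T powr (- alpha)\<close> bounds the probability of a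
  turning time in \<open>{T<..T + 1}\<close>.
  
  In the constant, \<open>16384 = 128 * 16 * 8\<close>, where \<open>128\<close> comes from \<open>comb_separation\<close>, the factor
  \<open>exp (- 12) / 16\<close> bounds the probability of the pattern, and \<open>8\<close> instead of \<open>4\<close> absorbs the rounding of
  the number of cells.
\<close>

lemma expectation_cos_stopped_powr_le:
  fixes alpha T v :: real
  assumes lam: "lam = (\<lambda>t. t powr (- alpha))" and alpha: "0 \<le> alpha" "alpha < 1"
    and n: "1 \<le> n" and T: "1 \<le> T" "4 \<le> T powr (1 - alpha)" and v: "0 \<le> v"
  shows "expectation (\<lambda>w. indicator (turn_after T n) w * cos (v * stopped_walk T n w))
     \<le> T powr (- alpha) * exp (- (exp (- 12) / 16384 * T powr (1 - alpha) * min 1 ((v * T powr alpha)\<^sup>2)))"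
proof -
  define s where "s = T powr alpha"
  have s: "s > 0" "T powr (- alpha) * s = 1" "s * T powr (1 - alpha) = T"
    using T by (simp_all add: s_def flip: powr_add)
  obtain P N where P: "P > 0" and NP: "s \<le> real N * P" "real N * P \<le> 2 * s"
    and sep: "\<And>a x y. x \<in> comb a P N \<Longrightarrow> y \<in> comb (a + P / 2) P N \<Longrightarrow>
        \<bar>cos (v * (y - x))\<bar> \<le> 1 - min 1 ((v * s)\<^sup>2) / 128"
    using comb_separation[OF s(1) v] by metis
  define \<delta> where "\<delta> = min 1 ((v * s)\<^sup>2) / 128"
  have \<delta>: "0 \<le> \<delta>" "\<delta> \<le> 1 / 128" by (auto simp: \<delta>_def)
  define l where "l b = T / 2 + 2 * s * real b" for b :: nat
  define u where "u b = l b + 2 * s" for b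
  define A where "A b = comb (l b) P N" for b
  define B where "B b = comb (l b + P / 2) P N" for b
  define m where "m = nat \<lfloor>T powr (1 - alpha) / 4\<rfloor>"
  have m: "real m \<le> T powr (1 - alpha) / 4" "T powr (1 - alpha) / 8 \<le> real m"
  proof -
    have "real m = of_int \<lfloor>T powr (1 - alpha) / 4\<rfloor>" using T by (simp add: m_def)
    moreover have "1 \<le> m" using T unfolding m_def by linarith
    ultimately show "real m \<le> T powr (1 - alpha) / 4" "T powr (1 - alpha) / 8 \<le> real m"
      by linarith+
  qed
  have cell: "T / 2 \<le> l b" "u b \<le> T" if "b < m" for b
  proof -
    have "2 * s * (real b + 1) \<le> 2 * s * real m" using that s by (intro mult_left_mono) auto
    also have "\<dots> \<le> 2 * s * (T powr (1 - alpha) / 4)" using m s by (intro mult_left_mono) auto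
    also have "\<dots> = T / 2" using s(3) by simp
    finally show "u b \<le> T" by (simp add: u_def l_def algebra_simps)
    show "T / 2 \<le> l b" using s by (simp add: l_def)
  qed
  have disj: "disjoint_family_on (\<lambda>b. {l b..<u b}) {..<m}"
  proof (unfold disjoint_family_on_def, intro ballI impI)
    fix b b' :: nat assume "b \<noteq> b'"
    then have "b + 1 \<le> b' \<or> b' + 1 \<le> b" by auto
    then have "real b + 1 \<le> real b' \<or> real b' + 1 \<le> real b" by linarith
    then have "u b \<le> l b' \<or> u b' \<le> l b"
      using s mult_left_mono[of "real b + 1" "real b'" "2 * s"] mult_left_mono[of "real b' + 1" "real b" "2 * s"]
      by (auto simp: u_def l_def algebra_simps)
    then show "{l b..<u b} \<inter> {l b'..<u b'} = {}" by auto
  qed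
  have AB: "A b \<subseteq> {l b..<u b}" "B b \<subseteq> {l b..<u b}" "A b \<inter> B b = {}" for b
    using comb_subset[OF P, of "l b" N] NP(2) comb_disjoint[OF P] unfolding A_def B_def u_def
    by (auto intro: less_le_trans)
  let ?\<mu> = "\<lambda>S. LINT t:S|lborel. lam t"
  have mu_le: "?\<mu> S \<le> 4" "0 \<le> ?\<mu> S" if S: "S \<in> sets borel" "S \<subseteq> {l b..<u b}" and b: "b < m" for S b
  proof -
    have sub: "S \<subseteq> {T / 2..T}" using S(2) cell[OF b] by force
    have "?\<mu> S \<le> (T / 2) powr (- alpha) * measure lborel S"
      unfolding lam using alpha T S sub by (intro powr_integral_bounds) auto
    also have "\<dots> \<le> (2 * T powr (- alpha)) * (2 * s)"
    proof (rule mult_mono)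
      have "(T / 2) powr (- alpha) = 2 powr alpha * T powr (- alpha)"
        using T by (simp add: powr_divide powr_minus divide_simps)
      also have "\<dots> \<le> 2 powr 1 * T powr (- alpha)"
        using alpha by (intro mult_right_mono powr_mono) auto
      finally show "(T / 2) powr (- alpha) \<le> 2 * T powr (- alpha)" by simp
      have "emeasure lborel {l b..<u b} < \<infinity>" using s by (simp add: u_def)
      then have "measure lborel S \<le> measure lborel {l b..<u b}"
        using S by (intro measure_mono_fmeasurable) (auto simp: fmeasurable_def)
      then show "measure lborel S \<le> 2 * s" using s by (simp add: u_def)
    qed auto
    also have "\<dots> = 4" using s(2) by simp
    finally show "?\<mu> S \<le> 4" .
    have "0 \<le> T powr (- alpha) * measure lborel S" by simp
    also have "\<dots> \<le> ?\<mu> S"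
      unfolding lam using alpha T S sub by (intro powr_integral_bounds) auto
    finally show "0 \<le> ?\<mu> S" .
  qed
  have mu_comb: "1 / 4 \<le> ?\<mu> (comb a P N)" if S: "comb a P N \<subseteq> {l b..<u b}" and b: "b < m" for a b
  proof -
    have sub: "comb a P N \<subseteq> {T / 2..T}" using S cell[OF b] by force
    have "1 / 4 = T powr (- alpha) * (s / 4)" using s(2) by simp
    also have "\<dots> \<le> T powr (- alpha) * measure lborel (comb a P N)"
      using NP(1) by (intro mult_left_mono) (auto simp: measure_comb[OF P])
    also have "\<dots> \<le> ?\<mu> (comb a P N)"
      unfolding lam using alpha T sub by (intro powr_integral_bounds) auto
    finally show ?thesis .
  qed
  have "expectation (\<lambda>w. indicator (turn_after T n) w * cos (v * stopped_walk T n w))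
     \<le> (1 - exp (- ?\<mu> {T<..T + 1})) * (\<Prod>b<m. 1 - (1 - (1 - \<delta>)) * (?\<mu> (A b) * ?\<mu> (B b) *
           exp (- (?\<mu> (A b) + ?\<mu> (B b) + ?\<mu> ({l b..<u b} - (A b \<union> B b))))))"
  proof (rule expectation_cos_stopped_le[OF n _ disj])
    show "0 \<le> l b \<and> u b \<le> T" if "b < m" for b using cell[OF that] T by auto
    show "A b \<subseteq> {l b..<u b} \<and> B b \<subseteq> {l b..<u b} \<and> A b \<inter> B b = {}" for b using AB by blast
    show "A b \<in> sets borel \<and> B b \<in> sets borel" for b by (simp add: A_def B_def)
    show "\<bar>cos (v * (y - x))\<bar> \<le> 1 - \<delta>" if "x \<in> A b" "y \<in> B b" for b x y
      using sep that unfolding A_def B_def \<delta>_def by blast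
  qed (use T \<delta> in auto)
  also have "\<dots> \<le> T powr (- alpha) * (\<Prod>b<m. exp (- (\<delta> * (exp (- 12) / 16))))"
  proof (intro mult_mono prod_mono conjI prod_nonneg)
    have "1 - exp (- ?\<mu> {T<..T + 1}) \<le> ?\<mu> {T<..T + 1}"
      using exp_ge_add_one_self[of "- ?\<mu> {T<..T + 1}"] by simp
    also have "\<dots> \<le> T powr (- alpha) * measure lborel {T<..T + 1}"
      unfolding lam using alpha T by (intro powr_integral_bounds[where y = "T + 1"]) auto
    finally show "1 - exp (- ?\<mu> {T<..T + 1}) \<le> T powr (- alpha)" by simp
    fix b assume "b \<in> {..<m}"
    then have b: "b < m" by simp
    let ?C = "{l b..<u b} - (A b \<union> B b)"
    have borel: "A b \<in> sets borel" "B b \<in> sets borel" by (simp_all add: A_def B_def)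
    note a = mu_le[OF borel(1) AB(1) b] mu_comb[of "l b" b, folded A_def, OF AB(1) b]
    note c = mu_le[OF borel(2) AB(2) b] mu_comb[of "l b + P / 2" b, folded B_def, OF AB(2) b]
    have d: "?\<mu> ?C \<le> 4" "0 \<le> ?\<mu> ?C" using borel by (intro mu_le[of _ b] b; auto)+
    let ?p = "?\<mu> (A b) * ?\<mu> (B b) * exp (- (?\<mu> (A b) + ?\<mu> (B b) + ?\<mu> ?C))"
    have "?p \<le> (4 * 4) * 1" using a c d by (intro mult_mono) auto
    then have p_le: "?p \<le> 16" by simp
    have "(1 / 4 * (1 / 4)) * exp (- 12) \<le> ?p" using a c d by (intro mult_mono) auto
    then have p_ge: "exp (- 12) / 16 \<le> ?p" by simp
    \<comment> \<open>Nonnegativity of the factors is needed to multiply the bounds.\<close>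
    have "\<delta> * ?p \<le> 1 / 128 * 16" using \<delta> a c p_le by (intro mult_mono) auto
    then show "0 \<le> 1 - (1 - (1 - \<delta>)) * ?p" by simp
    then show "0 \<le> 1 - (1 - (1 - \<delta>)) * ?p" .
    have "1 - (1 - (1 - \<delta>)) * ?p \<le> exp (- (\<delta> * ?p))"
      using exp_ge_add_one_self[of "- (\<delta> * ?p)"] by simp
    also have "\<dots> \<le> exp (- (\<delta> * (exp (- 12) / 16)))"
      using mult_left_mono[OF p_ge \<delta>(1)] by simp
    finally show "1 - (1 - (1 - \<delta>)) * ?p \<le> exp (- (\<delta> * (exp (- 12) / 16)))" .
  qed auto
  also have "(\<Prod>b<m. exp (- (\<delta> * (exp (- 12) / 16)))) = exp (- (real m * (\<delta> * (exp (- 12) / 16))))"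
    by (simp add: exp_of_nat_mult[symmetric])
  also have "T powr (- alpha) * \<dots> \<le> T powr (- alpha) * exp (- (T powr (1 - alpha) / 8 * (\<delta> * (exp (- 12) / 16))))"
    using mult_right_mono[OF m(2), of "\<delta> * (exp (- 12) / 16)"] \<delta>
    by (intro mult_left_mono) auto
  also have "T powr (1 - alpha) / 8 * (\<delta> * (exp (- 12) / 16))
      = exp (- 12) / 16384 * T powr (1 - alpha) * min 1 ((v * T powr alpha)\<^sup>2)"
    by (simp add: \<delta>_def s_def)
  finally show ?thesis .
qed

text \<open>
  Integrating over the frequency: the part with the square is concentrated on \<open>u / R\<close> of order
  \<open>T powr (- (1 + alpha) / 2)\<close>, the inverse of the standard deviation of the path at time \<open>T\<close>, and this is
  the order of the local probability. The part with \<open>exp (- K)\<close>, from the higher frequencies, is negligible.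
\<close>

lemma prob_near_origin_le:
  fixes alpha T R :: real
  assumes lam: "lam = (\<lambda>t. t powr (- alpha))" and alpha: "0 \<le> alpha" "alpha < 1"
    and n: "1 \<le> n" and T: "1 \<le> T" "4 \<le> T powr (1 - alpha)" and R: "R > 0"
  defines "\<kappa> \<equiv> exp (- 12) / 16384"
  shows "prob (near_origin R T n) \<le> 4 * (T powr (- alpha) *
     (2 * R / sqrt \<kappa> * T powr (- (1 + alpha) / 2) + exp (- (\<kappa> * T powr (1 - alpha)))))"
proof -
  define K where "K = \<kappa> * T powr (1 - alpha)"
  define k where "k = T powr alpha / R * sqrt K"
  have "\<kappa> > 0" by (simp add: \<kappa>_def)
  then have K: "K > 0" using T by (simp add: K_def)
  then have k: "k > 0" using R T by (simp add: k_def)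
  define G where "G u = T powr (- alpha) * (1 / (1 + (k * u)\<^sup>2) + exp (- K))" for u
  have nz: "1 + (k * u)\<^sup>2 \<noteq> 0" for u :: real by (smt (verit) zero_le_power2)
  have int: "set_integrable lborel {0..1} (\<lambda>u. 1 / (1 + (k * u)\<^sup>2))" "set_integrable lborel {0..1} (\<lambda>u::real. exp (- K))"
    using nz by (auto intro!: borel_integrable_atLeastAtMost' continuous_intros)
  have "prob (near_origin R T n) \<le> 4 * (LINT u:{0..1}|lborel. G u)"
  proof (rule prob_near_origin_le_integral[OF R])
    show "set_integrable lborel {0..1} G" unfolding G_def
      using int by (intro set_integrable_mult_right set_integral_add) auto
    show "0 \<le> G u" for u by (simp add: G_def)
    fix u :: real assume u: "u \<in> {0..1}"
    have "expectation (\<lambda>w. indicator (turn_after T n) w * cos (u / R * stopped_walk T n w))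
       \<le> T powr (- alpha) * exp (- (K * min 1 ((u / R * T powr alpha)\<^sup>2)))"
      using expectation_cos_stopped_powr_le[OF lam alpha n T, of "u / R"] u R
      unfolding K_def \<kappa>_def by simp
    also have "\<dots> \<le> G u" unfolding G_def
    proof (rule mult_left_mono)
      \<comment> \<open>The minimum is split: one case gives the exponential of a square, the other exp (- K).\<close>
      have eq: "K * (u / R * T powr alpha)\<^sup>2 = (k * u)\<^sup>2"
        using K by (simp add: k_def power_mult_distrib power_divide)
      have "exp (- ((k * u)\<^sup>2)) \<le> 1 / (1 + (k * u)\<^sup>2)"
        using exp_ge_add_one_self[of "(k * u)\<^sup>2"] le_imp_inverse_le[of "1 + (k * u)\<^sup>2" "exp ((k * u)\<^sup>2)"]
        by (simp add: exp_minus inverse_eq_divide add_pos_nonneg)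
      then show "exp (- (K * min 1 ((u / R * T powr alpha)\<^sup>2))) \<le> 1 / (1 + (k * u)\<^sup>2) + exp (- K)"
        unfolding min_def using eq by (auto intro: add_increasing add_increasing2)
    qed simp
    finally show "expectation (\<lambda>w. indicator (turn_after T n) w * cos (u / R * stopped_walk T n w)) \<le> G u" .
  qed
  also have "(LINT u:{0..1}|lborel. G u) = T powr (- alpha) * ((LINT u:{0..1}|lborel. 1 / (1 + (k * u)\<^sup>2)) + exp (- K))"
    unfolding G_def using int by (simp add: set_integral_add) (simp add: set_lebesgue_integral_def)
  also have "4 * \<dots> \<le> 4 * (T powr (- alpha) * (2 / k + exp (- K)))"
    using integral_inverse_one_plus_square_le[OF k] by (intro mult_left_mono add_right_mono) auto
  also have "2 / k = 2 * R / sqrt \<kappa> * T powr (- (1 + alpha) / 2)"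
  proof -
    have "T powr alpha * sqrt (T powr (1 - alpha)) = T powr ((1 + alpha) / 2)"
      using T by (simp add: powr_half_sqrt[symmetric] powr_powr flip: powr_add) (simp add: field_simps)
    then have k_eq: "k = sqrt \<kappa> * T powr ((1 + alpha) / 2) / R"
      by (simp add: k_def K_def real_sqrt_mult)
    have pow_eq: "T powr (- (1 + alpha) / 2) = inverse (T powr ((1 + alpha) / 2))"
      unfolding powr_minus[symmetric] minus_divide_left ..
    have "2 / (a * x / R) = 2 * R / a * inverse x" for a x :: real
      by (simp add: field_simps)
    then show ?thesis unfolding k_eq pow_eq .
  qed
  finally show ?thesis unfolding K_def .
qed

text \<open>
  Almost surely the events \<open>near_origin R T n\<close> increase with \<open>n\<close>, so a bound that is uniform in \<open>n\<close>
  passes to their union.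
\<close>

lemma prob_near_origin_some_le:
  assumes bound: "\<And>n. 1 \<le> n \<Longrightarrow> prob (near_origin R T n) \<le> c" and c: "0 \<le> c"
  shows "prob (\<Union>n\<in>{1..}. near_origin R T n) \<le> c"
proof -
  define U where "U N = (\<Union>n\<in>{1..N}. near_origin R T n)" for N :: nat
  have "(\<lambda>N. prob (U N)) \<longlonglongrightarrow> prob (\<Union>N. U N)"
  proof (rule finite_Lim_measure_incseq)
    show "incseq U" unfolding incseq_def U_def by (intro allI impI UN_mono) auto
  qed (auto simp: U_def)
  moreover have "prob (U N) \<le> c" for N
  proof (cases "N = 0")
    case True
    then show ?thesis using c by (simp add: U_def)
  next
    case False
    have "prob (U N) \<le> prob (near_origin R T N)"
    proof (rule finite_measure_mono_AE)
      show "AE w in M. w \<in> U N \<longrightarrow> w \<in> near_origin R T N"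
        using tau_increasing
      proof eventually_elim
        case (elim w)
        show ?case
        proof
          assume "w \<in> U N"
          then obtain n where n: "1 \<le> n" "n \<le> N" "w \<in> near_origin R T n" by (auto simp: U_def)
          have later: "T < tau k w" if "n \<le> k" for k
            using strict_mono_on_leD[OF elim, of n k] that n by (auto simp: near_origin_def turn_after_def)
          have "stopped_walk T N w = stopped_walk T n w + (\<Sum>k\<in>{n..<N}. (min (tau (Suc k) w) T - min (tau k w) T) * f k w)"
            unfolding stopped_walk_def lessThan_atLeast0 using n by (intro sum.atLeastLessThan_concat[symmetric]) auto
          also have "(\<Sum>k\<in>{n..<N}. (min (tau (Suc k) w) T - min (tau k w) T) * f k w) = 0"
          proof (rule sum.neutral, rule ballI)
            fix k assume "k \<in> {n..<N}"
            then show "(min (tau (Suc k) w) T - min (tau k w) T) * f k w = 0"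
              using later[of k] later[of "Suc k"] by auto
          qed
          finally show "w \<in> near_origin R T N"
            using n later[of N] by (auto simp: near_origin_def turn_after_def)
        qed
      qed
    qed auto
    also have "\<dots> \<le> c" using bound[of N] False by simp
    finally show ?thesis .
  qed
  ultimately have "prob (\<Union>N. U N) \<le> c" by (blast intro: LIMSEQ_le_const2)
  also have "(\<Union>N. U N) = (\<Union>n\<in>{1..}. near_origin R T n)" unfolding U_def by fastforce
  finally show ?thesis .
qed

end

section \<open>Summability and transience\<close>

text \<open>
  The exponent of the main term is \<open>- (1 + 3 * alpha) / 2\<close>, which is below \<open>- 1\<close> exactly when
  \<open>alpha > 1 / 3\<close>.
\<close>

lemma summable_near_origin_bound:
  fixes alpha C \<kappa> :: real
  assumes alpha: "1 / 3 < alpha" "alpha < 1" and \<kappa>: "\<kappa> > 0"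
  shows "summable (\<lambda>j::nat. 4 * (real j powr (- alpha) *
     (C * real j powr (- (1 + alpha) / 2) + exp (- (\<kappa> * real j powr (1 - alpha))))))"
proof -
  have "summable (\<lambda>j::nat. real j powr (- alpha + - (1 + alpha) / 2))"
    using alpha by (simp add: summable_real_powr_iff field_simps)
  then have 1: "summable (\<lambda>j::nat. real j powr (- alpha) * (C * real j powr (- (1 + alpha) / 2)))"
    unfolding powr_add by (rule summable_mult[of _ C, THEN summable_cong[THEN iffD1, rotated]]) (simp add: mult_ac)
  have 2: "summable (\<lambda>j::nat. real j powr (- alpha) * exp (- (\<kappa> * real j powr (1 - alpha))))"
  proof (rule summable_comparison_test_bigo)
    show "summable (\<lambda>j::nat. norm (real j powr (- 2)))" by (simp add: summable_real_powr_iff)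
    show "(\<lambda>j::nat. real j powr (- alpha) * exp (- (\<kappa> * real j powr (1 - alpha)))) \<in> O(\<lambda>j. real j powr (- 2))"
      using alpha \<kappa> by real_asymp
  qed
  show ?thesis using summable_mult[OF summable_add[OF 1 2], of 4] by (simp add: distrib_left)
qed

lemma strict_mono_locally_finite_at_top:
  fixes t :: "nat \<Rightarrow> real"
  assumes mono: "strict_mono_on {1..} t" and nonneg: "t ` {1..} \<subseteq> {0..}"
    and fin: "\<And>T. finite (t ` {1..} \<inter> {0..T})"
  shows "filterlim t at_top sequentially"
  unfolding filterlim_at_top_dense
proof
  fix T
  have "t ` {k \<in> {1..}. t k \<le> T} \<subseteq> t ` {1..} \<inter> {0..T}" using nonneg by auto
  moreover have "inj_on t {k \<in> {1..}. t k \<le> T}"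
    using strict_mono_on_imp_inj_on[OF mono] by (rule inj_on_subset) auto
  ultimately have "finite {k \<in> {1..}. t k \<le> T}"
    using fin[of T] by (meson finite_imageD finite_subset)
  then have "eventually (\<lambda>k. k \<notin> {k \<in> {1..}. t k \<le> T}) sequentially"
    unfolding cofinite_eq_sequentially[symmetric] eventually_cofinite by simp
  then show "eventually (\<lambda>k. T < t k) sequentially"
    using eventually_ge_at_top[of 1] by eventually_elim auto
qed

context linear_conservative_walk
begin

lemma AE_abs_sign_le_1: "AE w in M. \<forall>k. \<bar>f k w\<bar> \<le> 1"
proof (unfold AE_all_countable, rule allI)
  fix k
  note f_measurable [measurable]
  have "AE x in distr (measure_pmf (pmf_of_set {1, -1 :: real})) borel (\<lambda>v. v). \<bar>x\<bar> \<le> 1"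
    by (subst AE_distr_iff) (auto simp: AE_measure_pmf_iff)
  then have "AE x in distr M borel (f k). \<bar>x\<bar> \<le> 1" unfolding f_uniform signed_unit_vectors_real .
  then show "AE w in M. \<bar>f k w\<bar> \<le> 1" by (subst (asm) AE_distr_iff) auto
qed

text \<open>
  By Borel--Cantelli, for every \<open>R\<close> only finitely many \<open>j\<close> have a turning time in \<open>{j<..j + 1}\<close> together
  with \<open>\<bar>stopped_walk j n\<bar> \<le> R + 1\<close>. A return of the embedded process to \<open>[-R, R]\<close> at a turning time in that
  interval would be such an event, because the path moves by at most one in the meantime.
\<close>

lemma AE_transient:
  fixes alpha :: real
  assumes lam: "lam = (\<lambda>t. t powr (- alpha))" and alpha: "1 / 3 < alpha" "alpha < 1"
  shows "AE w in M. transient (\<lambda>n. embedded_process tau f n w)"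
proof -
  define E where "E R j = (\<Union>n\<in>{1..}. near_origin (real R + 1) (real j) n)" for R j :: nat
  have E_event [measurable]: "E R j \<in> events" for R j unfolding E_def by measurable
  have "AE w in M. \<forall>R. eventually (\<lambda>j. w \<in> space M - E R j) sequentially"
  proof (unfold AE_all_countable, rule allI, rule borel_cantelli_AE1)
    fix R :: nat
    define c where "c j = 4 * (real j powr (- alpha) * (2 * (real R + 1) / sqrt (exp (- 12) / 16384) *
        real j powr (- (1 + alpha) / 2) + exp (- (exp (- 12) / 16384 * real j powr (1 - alpha)))))" for j :: nat
    have "eventually (\<lambda>j::nat. 4 \<le> real j powr (1 - alpha)) sequentially"
      using alpha by real_asymp
    then have "eventually (\<lambda>j. norm (prob (E R j)) \<le> c j) sequentially"
      using eventually_ge_at_top[of 1]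
    proof eventually_elim
      case (elim j)
      have "prob (E R j) \<le> c j" unfolding E_def
      proof (rule prob_near_origin_some_le)
        show "prob (near_origin (real R + 1) (real j) n) \<le> c j" if "1 \<le> n" for n
          unfolding c_def using elim alpha that by (intro prob_near_origin_le[OF lam]) auto
        show "0 \<le> c j" by (simp add: c_def)
      qed
      then show ?case by simp
    qed
    moreover have "summable c" unfolding c_def[abs_def]
      by (rule summable_near_origin_bound[OF alpha]) simp
    ultimately show "summable (\<lambda>j. prob (E R j))" by (rule summable_comparison_test_ev)
    show "emeasure M (E R j) < \<infinity>" for j by (simp add: less_top[symmetric])
  qed auto
  moreover have "AE w in M. (\<lambda>k. tau k w) ` {1..} \<subseteq> {0..} \<and> (\<forall>T. finite ((\<lambda>k. tau k w) ` {1..} \<inter> {0..T}))"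
    using tau_poisson unfolding poisson_point_process_def by blast
  moreover have "AE w in M. w \<in> space M" by (rule AE_space)
  ultimately show ?thesis using AE_abs_sign_le_1 tau_increasing
  proof eventually_elim
    case (elim w)
    define t where "t k = tau k w" for k
    have mono: "strict_mono_on {1..} t" using elim by (simp add: t_def[abs_def])
    have nonneg: "t ` {1..} \<subseteq> {0..}" and fin: "finite (t ` {1..} \<inter> {0..T})" for T
      using elim by (simp_all add: t_def[abs_def])
    have t0: "t 0 = 0" using tau_0 elim by (simp add: t_def)
    have step: "t k \<le> t (Suc k)" for k
    proof (cases "k = 0")
      case True
      then show ?thesis using nonneg t0 by force
    next
      case False
      then show ?thesis using strict_mono_onD[OF mono, of k "Suc k"] by simp
    qed
    have t_top: "filterlim t at_top sequentially"
      by (rule strict_mono_locally_finite_at_top[OF mono nonneg fin])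
    show ?case unfolding transient_def
    proof (intro allI impI notI)
      fix rho :: real
      assume rho: "rho > 0" and "recurrent_radius rho (\<lambda>n. embedded_process tau f n w)"
      then obtain N :: "nat \<Rightarrow> nat" where N: "strict_mono N" "\<And>i. 1 \<le> N i"
          and near: "\<And>i. embedded_process tau f (N i) w \<in> cbox (- (rho *\<^sub>R One)) (rho *\<^sub>R One)"
        unfolding recurrent_radius_def by blast
      have near: "\<bar>embedded_process tau f (N i) w\<bar> \<le> rho" for i
        using near[of i] by (simp add: abs_le_iff minus_le_iff)
      obtain R :: nat where R: "rho \<le> real R" using real_arch_simple by blast
      have "eventually (\<lambda>j. w \<in> space M - E R j) sequentially"
        using elim(1) by (rule spec)
      then obtain J where J: "\<And>j. J \<le> j \<Longrightarrow> w \<notin> E R j"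
        by (auto simp: eventually_sequentially)
      have "filterlim (\<lambda>i. t (N i)) at_top sequentially"
        by (rule filterlim_compose[OF t_top filterlim_subseq[OF N(1)]])
      then have "eventually (\<lambda>i. real J + 1 \<le> t (N i)) sequentially"
        unfolding filterlim_at_top by blast
      then obtain i where i: "real J + 1 \<le> t (N i)" by (auto simp: eventually_sequentially)
      define n where "n = N i"
      \<comment> \<open>The interval {j<..j + 1} is open on the left, hence a ceiling and not a floor.\<close>
      define j where "j = nat (\<lceil>t n\<rceil> - 1)"
      have j: "real j < t n" "t n \<le> real j + 1" "J \<le> j"
        using i unfolding j_def n_def by linarith+
      have n: "1 \<le> n" using N(2) n_def by simp
      have "\<bar>stopped_walk (real j) n w - embedded_process tau f n w\<bar> \<le> t n - real j"
        using stopped_sum_close[OF t0 step _ j(1), of "\<lambda>k. f k w"] elim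
        by (simp add: stopped_walk_def embedded_process_def t_def)
      then have "\<bar>stopped_walk (real j) n w\<bar> \<le> real R + 1"
        using near[of i] R j(2) unfolding n_def[symmetric] by linarith
      moreover have "w \<in> turn_after (real j) n"
        using elim n j(1,2) unfolding turn_after_def t_def by auto
      ultimately have "w \<in> E R j" using n by (auto simp: E_def near_origin_def)
      with J[OF j(3)] show False by simp
    qed
  qed
qed

end

theorem theorem1:
  fixes M :: "'a measure"
    and alpha :: real
    and tau :: "nat \<Rightarrow> 'a \<Rightarrow> real"
    and f :: "nat \<Rightarrow> 'a \<Rightarrow> real"
  assumes "1 / 3 < alpha" and "alpha < 1"
    and "orthogonal_conservative_walk M (\<lambda>t. t powr (- alpha)) tau f"
  shows "AE w in M. transient (\<lambda>n. embedded_process tau f n w)"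
proof -
  interpret linear_conservative_walk M "\<lambda>t. t powr (- alpha)" tau f
    using assms(3) by (simp add: linear_conservative_walk_def)
  show ?thesis using AE_transient[OF refl assms(1,2)] .
qed

end
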